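(* For every even integer $n\geq 6$, $\Pi^{bichrom}(n)\geq \left\lceil \frac{n-2}{36}\right\rceil+2$. That is, for every simple polygon $P$ and every set $S$ in general position in $P$ of $n/2$ red and $n/2$ blue points, there exist a red point $r$ and a blue point $b$ of $S$ such that every geodesic disk through $r$ and $b$ contains at least $\left\lceil \frac{n-2}{36}\right\rceil+2$ points of $S$.
   Context: $P$ is a simple polygon (a closed region). For $a,b\in P$, $g(a,b)$ denotes the shortest (geodesic) path from $a$ to $b$ inside $P$ and $|g(a,b)|$ its length. A geodesic disk with center $c$ and radius $r$ is $D(c,r)=\{x\in P:|g(c,x)|\le r\}$; it is "through" some points if those points lie on its boundary (distance exactly $r$ from $c$), and contains a point if the point belongs to it. General position of $S$: no three points of $S$ are geodesically collinear (one on the geodesic path between the other two), no four points among $S$ and the vertices of $P$ lie on the boundary of a common geodesic disk, there are no $x,y\in S$ and reflex vertex $p$ of $P$ with $y\in g(x,p)$, and no geodesic bisector of two points of $S$ passes through a vertex of $P$. $\Pi^{bichrom}(n)$ is the largest integer such that for every simple polygon $P$ and every such set $S$ of $n/2$ red and $n/2$ blue points, there exist a red point $r$ and a blue point $b$ such that every geodesic disk through them contains at least $\Pi^{bichrom}(n)$ points of $S$. *)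

theory Defs
  imports "HOL-Analysis.Analysis"
begin

definition pedge :: "complex list \<Rightarrow> nat \<Rightarrow> complex set" where
  "pedge vs i = closed_segment (vs ! i) (vs ! ((i + 1) mod length vs))"

definition simple_polygon_vertices :: "complex list \<Rightarrow> bool" where
  "simple_polygon_vertices vs \<longleftrightarrow>
     length vs \<ge> 3 \<and> distinct vs \<and>
     (\<forall>i < length vs. \<not> collinear {vs ! i, vs ! ((i + 1) mod length vs), vs ! ((i + 2) mod length vs)}) \<and>
     (\<forall>i < length vs. \<forall>j < length vs. i \<noteq> j \<longrightarrow>
        (if j = (i + 1) mod length vs then pedge vs i \<inter> pedge vs j = {vs ! j}
         else if i = (j + 1) mod length vs then pedge vs i \<inter> pedge vs j = {vs ! i}
         else pedge vs i \<inter> pedge vs j = {}))"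

definition pboundary :: "complex list \<Rightarrow> complex set" where
  "pboundary vs = (\<Union>i < length vs. pedge vs i)"

definition pregion :: "complex list \<Rightarrow> complex set" where
  "pregion vs = pboundary vs \<union> inside (pboundary vs)"

text \<open>Reflex vertex: interior angle > pi, i.e. the region is not locally convex at it.\<close>
definition reflex_vertex :: "complex list \<Rightarrow> complex \<Rightarrow> bool" where
  "reflex_vertex vs p \<longleftrightarrow> p \<in> set vs \<and>
     (\<forall>e > 0. \<not> convex (pregion vs \<inter> cball p e))"

definition poly_path_in :: "complex set \<Rightarrow> complex list \<Rightarrow> complex \<Rightarrow> complex \<Rightarrow> bool" where
  "poly_path_in P ps a b \<longleftrightarrow> ps \<noteq> [] \<and> hd ps = a \<and> last ps = b \<and>
     (\<forall>i. Suc i < length ps \<longrightarrow> closed_segment (ps ! i) (ps ! Suc i) \<subseteq> P)"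

definition poly_len :: "complex list \<Rightarrow> real" where
  "poly_len ps = (\<Sum>i < length ps - 1. dist (ps ! i) (ps ! Suc i))"

definition poly_image :: "complex list \<Rightarrow> complex set" where
  "poly_image ps = set ps \<union> (\<Union>i \<in> {i. Suc i < length ps}. closed_segment (ps ! i) (ps ! Suc i))"

text \<open>Geodesic distance |g(a,b)| in P (shortest paths in simple polygons are polygonal).\<close>
definition gdist :: "complex set \<Rightarrow> complex \<Rightarrow> complex \<Rightarrow> real" where
  "gdist P a b = Inf (poly_len ` {ps. poly_path_in P ps a b})"

definition on_geodesic :: "complex set \<Rightarrow> complex \<Rightarrow> complex \<Rightarrow> complex \<Rightarrow> bool" where
  "on_geodesic P y a b \<longleftrightarrow>
     (\<exists>ps. poly_path_in P ps a b \<and> poly_len ps = gdist P a b \<and> y \<in> poly_image ps)"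

definition general_position :: "complex list \<Rightarrow> complex set \<Rightarrow> bool" where
  "general_position vs S \<longleftrightarrow>
     (let P = pregion vs in
       (\<forall>x\<in>S. \<forall>y\<in>S. \<forall>z\<in>S. x \<noteq> y \<and> y \<noteq> z \<and> x \<noteq> z \<longrightarrow> \<not> on_geodesic P y x z) \<and>
       (\<forall>q1 q2 q3 q4. {q1, q2, q3, q4} \<subseteq> S \<union> set vs \<and> card {q1, q2, q3, q4} = 4 \<longrightarrow>
          \<not> (\<exists>c\<in>P. \<exists>r. gdist P c q1 = r \<and> gdist P c q2 = r \<and> gdist P c q3 = r \<and> gdist P c q4 = r)) \<and>
       (\<forall>x\<in>S. \<forall>y\<in>S. \<forall>p. x \<noteq> y \<and> reflex_vertex vs p \<longrightarrow> \<not> on_geodesic P y x p) \<and>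
       (\<forall>x\<in>S. \<forall>y\<in>S. \<forall>v\<in>set vs. x \<noteq> y \<longrightarrow> gdist P x v \<noteq> gdist P y v))"

end

theory Submission
  imports Defs
begin

text \<open>
  If three red and three blue points were such that each of the nine bichromatic pairs has a geodesic
  disk through it avoiding the other four points, then joining the centres of these disks to the two
  points by geodesics would draw \<open>K\<^sub>3\<^sub>,\<^sub>3\<close> in the plane: every geodesic stays in the Voronoi cell
  of its endpoint. Hence among any six such points some disk of any prescribed choice through \<open>r\<close> and
  \<open>b\<close> contains a third point \<open>s\<close>. A triple \<open>(r, b, s)\<close> belongs to \<open>(m - 2) * (m - 1 choose 2)\<close> of the
  \<open>(m choose 3)\<^sup>2\<close> six-tuples, where \<open>m = n / 2\<close>, so some pair \<open>(r, b)\<close> has at least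
  \<open>(m - 1) / 18\<close> companions \<open>s\<close>.
\<close>

subsection \<open>Geodesics in locally star-shaped planar sets\<close>

text \<open>Two obstacles stand between the geodesics and a planar drawing. A geodesic from the
  centre of an empty disk could run along the bisector of its two points or return to it, so the two
  halves of one edge could meet away from the centre. The centre is therefore replaced by one of
  least radius among the equidistant points whose disks stay inside the given empty disk. Moreover,
  the three geodesics that leave one point may overlap, part and meet again, so they form a star of
  arcs rather than three edges at a vertex. Each star is replaced by a tripod contained in it, whose
  hub takes over the role of the point. The polygon enters as a compact connected set in which every
  point sees a neighbourhood of itself; this suffices for a continuous intrinsic metric whose
  geodesics are arcs. The constants match because (m - 1) / 18 = (n - 2) / 36 for m = n / 2, and the
  summand 2 counts \<open>r\<close> and \<open>b\<close> themselves.\<close>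

inductive poly_reach :: "complex set \<Rightarrow> complex \<Rightarrow> complex \<Rightarrow> real \<Rightarrow> bool" for P where
  refl: "poly_reach P a a 0"
| step: "closed_segment a b \<subseteq> P \<Longrightarrow> poly_reach P b c l \<Longrightarrow> poly_reach P a c (dist a b + l)"

lemma poly_path_in_Cons_Cons:
  "poly_path_in P (a # b # ps) x y \<longleftrightarrow>
    a = x \<and> closed_segment a b \<subseteq> P \<and> poly_path_in P (b # ps) b y"
proof -
  have "(\<forall>i. Suc i < length (a # b # ps) \<longrightarrow> closed_segment ((a # b # ps) ! i) ((a # b # ps) ! Suc i) \<subseteq> P) \<longleftrightarrow>
    closed_segment a b \<subseteq> P \<and>
    (\<forall>i. Suc i < length (b # ps) \<longrightarrow> closed_segment ((b # ps) ! i) ((b # ps) ! Suc i) \<subseteq> P)"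
    by (metis (no_types, lifting) Suc_less_eq length_Cons not0_implies_Suc nth_Cons_0 nth_Cons_Suc zero_less_Suc)
  then show ?thesis
    by (auto simp: poly_path_in_def)
qed

lemma poly_len_Cons_Cons: "poly_len (a # b # ps) = dist a b + poly_len (b # ps)"
  by (simp add: poly_len_def sum.lessThan_Suc_shift del: sum.lessThan_Suc)

text \<open>Trades list indices for an inductive predicate on lengths, so that concatenation,
  reversal and length estimates of chains become inductions over their edges.\<close>

lemma poly_reach_iff:
  "poly_reach P a b l \<longleftrightarrow> (\<exists>ps. poly_path_in P ps a b \<and> poly_len ps = l)"
proof
  assume "poly_reach P a b l"
  then show "\<exists>ps. poly_path_in P ps a b \<and> poly_len ps = l"
  proof induction
    case (refl a)
    then show ?case
      by (intro exI[of _ "[a]"]) (simp add: poly_path_in_def poly_len_def)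
  next
    case (step a b c l)
    then obtain ps where ps: "poly_path_in P ps b c" "poly_len ps = l"
      by blast
    then obtain qs where "ps = b # qs"
      by (cases ps) (auto simp: poly_path_in_def)
    with ps step show ?case
      by (intro exI[of _ "a # ps"]) (simp add: poly_path_in_Cons_Cons poly_len_Cons_Cons)
  qed
next
  have "poly_reach P a b (poly_len ps)" if "poly_path_in P ps a b" for ps
    using that
  proof (induction ps arbitrary: a rule: induct_list012)
    case (2 x)
    then show ?case
      by (auto simp: poly_path_in_def poly_len_def intro: poly_reach.refl)
  next
    case (3 x y zs)
    then show ?case
      by (auto simp: poly_path_in_Cons_Cons poly_len_Cons_Cons intro: poly_reach.step)
  qed (simp add: poly_path_in_def)
  then show "\<exists>ps. poly_path_in P ps a b \<and> poly_len ps = l \<Longrightarrow> poly_reach P a b l"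
    by blast
qed

lemma gdist_eq_Inf_poly_reach: "gdist P a b = Inf {l. poly_reach P a b l}"
proof -
  have "poly_len ` {ps. poly_path_in P ps a b} = {l. poly_reach P a b l}"
    by (auto simp: poly_reach_iff)
  then show ?thesis
    by (simp add: gdist_def)
qed

lemma poly_reach_segment:
  "closed_segment a b \<subseteq> P \<Longrightarrow> poly_reach P a b (dist a b)"
  using poly_reach.step[OF _ poly_reach.refl, of a b P] by simp

lemma poly_reach_trans:
  "poly_reach P a b l \<Longrightarrow> poly_reach P b c k \<Longrightarrow> poly_reach P a c (l + k)"
  by (induction rule: poly_reach.induct) (auto simp: add.assoc intro: poly_reach.step)

lemma poly_reach_sym: "poly_reach P a b l \<Longrightarrow> poly_reach P b a l"
proof (induction rule: poly_reach.induct)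
  case (step a b c l)
  then have "poly_reach P c a (l + dist b a)"
    using poly_reach_trans[OF _ poly_reach_segment, of P c b l a] by (simp add: closed_segment_commute)
  then show ?case
    by (simp add: dist_commute add.commute)
qed (rule poly_reach.refl)

lemma dist_le_poly_reach: "poly_reach P a b l \<Longrightarrow> dist a b \<le> l"
proof (induction rule: poly_reach.induct)
  case (step a b c l)
  then show ?case
    using dist_triangle[of a c b] by simp
qed simp

lemma gdist_le: "poly_reach P a b l \<Longrightarrow> gdist P a b \<le> l"
  unfolding gdist_eq_Inf_poly_reach
  by (intro cInf_lower) (auto intro!: bdd_belowI[of _ "dist a b"] dist_le_poly_reach)

lemma gdist_commute: "gdist P a b = gdist P b a"
proof -
  have "{l. poly_reach P a b l} = {l. poly_reach P b a l}"
    by (auto intro: poly_reach_sym)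
  then show ?thesis
    by (simp add: gdist_eq_Inf_poly_reach)
qed

section \<open>The intrinsic metric of a compact, connected, locally star-shaped set\<close>

locale locally_starlike =
  fixes P :: "complex set"
  assumes compact: "compact P"
    and connected: "connected P"
    and starlike: "x \<in> P \<Longrightarrow> \<exists>e>0. \<forall>y\<in>P. dist x y < e \<longrightarrow> closed_segment x y \<subseteq> P"
begin

abbreviation d :: "complex \<Rightarrow> complex \<Rightarrow> real" where
  "d \<equiv> gdist P"

text \<open>Reachability is an equivalence relation whose classes are relatively open, since every
  point sees a neighbourhood of itself; connectedness leaves a single class. This keeps the set of
  lengths nonempty, so that \<open>Inf\<close> in \<open>gdist\<close> is a genuine infimum.\<close>

lemma poly_reach_exists:
  assumes "a \<in> P" "b \<in> P"
  shows "\<exists>l. poly_reach P a b l"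
proof (rule connected_equivalence_relation[OF connected assms])
  fix x assume x: "x \<in> P"
  then obtain e where e: "e > 0" "\<And>y. y \<in> P \<Longrightarrow> dist x y < e \<Longrightarrow> closed_segment x y \<subseteq> P"
    using starlike by metis
  then have "\<exists>l. poly_reach P x y l" if "y \<in> P \<inter> ball x e" for y
    using that poly_reach_segment[of x y P] by auto
  then show "\<exists>T. openin (top_of_set P) T \<and> x \<in> T \<and> (\<forall>y\<in>T. \<exists>l. poly_reach P x y l)"
    using x e(1) by (intro exI[of _ "P \<inter> ball x e"]) auto
qed (blast intro: poly_reach_sym poly_reach_trans)+

lemma gdist_approx:
  assumes "a \<in> P" "b \<in> P" "0 < e"
  obtains l where "poly_reach P a b l" "l < d a b + e"
proof -
  have "{l. poly_reach P a b l} \<noteq> {}"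
    using poly_reach_exists assms by auto
  from cInf_lessD[OF this, of "d a b + e"] show ?thesis
    using that assms by (auto simp: gdist_eq_Inf_poly_reach)
qed

lemma dist_le_gdist:
  assumes "a \<in> P" "b \<in> P"
  shows "dist a b \<le> d a b"
proof -
  have "{l. poly_reach P a b l} \<noteq> {}"
    using poly_reach_exists assms by auto
  then show ?thesis
    unfolding gdist_eq_Inf_poly_reach
    by (intro cInf_greatest) (auto intro: dist_le_poly_reach)
qed

lemma gdist_self: "a \<in> P \<Longrightarrow> d a a = 0"
  using dist_le_gdist[of a a] gdist_le[OF poly_reach.refl, of P a] by simp

lemma gdist_eq_0_iff: "a \<in> P \<Longrightarrow> b \<in> P \<Longrightarrow> d a b = 0 \<longleftrightarrow> a = b"
  using dist_le_gdist[of a b] gdist_self[of a] by auto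

lemma gdist_nonneg: "a \<in> P \<Longrightarrow> b \<in> P \<Longrightarrow> 0 \<le> d a b"
  using dist_le_gdist[of a b] zero_le_dist[of a b] by linarith

lemma gdist_triangle:
  assumes "a \<in> P" "b \<in> P" "c \<in> P"
  shows "d a c \<le> d a b + d b c"
proof (rule field_le_epsilon)
  fix e :: real assume "0 < e"
  then obtain l k where "poly_reach P a b l" "l < d a b + e / 2" "poly_reach P b c k" "k < d b c + e / 2"
    using gdist_approx[OF assms(1,2), of "e / 2"] gdist_approx[OF assms(2,3), of "e / 2"]
    by (metis half_gt_zero)
  then show "d a c \<le> d a b + d b c + e"
    using gdist_le[OF poly_reach_trans, of P a b l c k] by linarith
qed

lemma gdist_segment:
  assumes "closed_segment a b \<subseteq> P"
  shows "d a b = dist a b"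
  using gdist_le[OF poly_reach_segment[OF assms]] dist_le_gdist[of a b] assms
  by (meson ends_in_segment order_antisym subsetD)

text \<open>Near \<open>x\<close> the segment from \<open>x\<close> to \<open>y\<close> lies in
  \<open>P\<close>, so \<open>d x y\<close> is the Euclidean distance there and the triangle
  inequality for \<open>d\<close> gives continuity in the Euclidean topology.\<close>

lemma continuous_on_gdist:
  assumes "a \<in> P"
  shows "continuous_on P (d a)"
  unfolding continuous_on_iff
proof (intro ballI allI impI)
  fix x and e :: real
  assume x: "x \<in> P" and "0 < e"
  obtain r where r: "r > 0" "\<And>y. y \<in> P \<Longrightarrow> dist x y < r \<Longrightarrow> closed_segment x y \<subseteq> P"
    using starlike x by metis
  have "dist (d a y) (d a x) < e" if "y \<in> P" "dist y x < min r e" for y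
  proof -
    have "d x y < e"
      using gdist_segment[OF r(2)[OF \<open>y \<in> P\<close>]] that by (auto simp: dist_commute)
    then show ?thesis
      using gdist_triangle[OF assms x \<open>y \<in> P\<close>] gdist_triangle[OF assms \<open>y \<in> P\<close> x] gdist_commute[of P x y]
      by (auto simp: dist_real_def)
  qed
  then show "\<exists>r>0. \<forall>y\<in>P. dist y x < r \<longrightarrow> dist (d a y) (d a x) < e"
    using r(1) \<open>0 < e\<close> by (intro exI[of _ "min r e"]) auto
qed

text \<open>The point set traced by a chain of length \<open>l\<close>. Connectedness and the detour
  bound are all that is kept: they let the intermediate value theorem be applied to
  \<open>d a\<close> along a chain that is only nearly shortest.\<close>

lemma poly_reach_connected:
  assumes "poly_reach P a b l" "a \<in> P" "b \<in> P"
  shows "\<exists>K\<subseteq>P. connected K \<and> a \<in> K \<and> b \<in> K \<and> (\<forall>z\<in>K. d a z + d z b \<le> l)"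
  using assms
proof (induction rule: poly_reach.induct)
  case (refl a)
  then show ?case
    by (intro exI[of _ "{a}"]) (auto simp: gdist_self)
next
  case (step a b c l)
  then have "b \<in> P"
    by auto
  with step obtain K where K: "K \<subseteq> P" "connected K" "b \<in> K" "c \<in> K" "\<forall>z\<in>K. d b z + d z c \<le> l"
    by blast
  have "d a z + d z c \<le> dist a b + l" if "z \<in> closed_segment a b" for z
  proof -
    have "closed_segment a z \<subseteq> P" "closed_segment z b \<subseteq> P" "z \<in> P"
      using step(1) that subset_closed_segment[of a z a b] subset_closed_segment[of z b a b] by auto
    then have "d a z = dist a z" "d z b = dist z b"
      by (auto intro: gdist_segment)
    moreover have "d b c \<le> l"
      using K gdist_self[OF \<open>b \<in> P\<close>] by force
    moreover have "dist a b = dist a z + dist z b"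
      using that by (simp add: between_mem_segment[symmetric] between)
    ultimately show ?thesis
      using gdist_triangle[OF \<open>z \<in> P\<close> \<open>b \<in> P\<close> \<open>c \<in> P\<close>] by linarith
  qed
  moreover have "d a z + d z c \<le> dist a b + l" if "z \<in> K" for z
    using gdist_triangle[OF \<open>a \<in> P\<close> \<open>b \<in> P\<close>, of z] gdist_segment[OF step(1)] K that by force
  moreover have "connected (closed_segment a b \<union> K)"
    using K by (intro connected_Un) auto
  ultimately show ?case
    using K step(1) by (intro exI[of _ "closed_segment a b \<union> K"]) auto
qed

text \<open>A chain of length below \<open>d a b + e\<close> crosses the level set
  \<open>d a z = t\<close>, at a point whose distance to \<open>b\<close> exceeds
  \<open>d a b - t\<close> by at most \<open>e\<close>. The level set is compact, so a point of it
  nearest to \<open>b\<close> removes the error.\<close>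

lemma gdist_intermediate:
  assumes "a \<in> P" "b \<in> P" "0 \<le> t" "t \<le> d a b"
  obtains z where "z \<in> P" "d a z = t" "d z b = d a b - t"
proof -
  have ex: "\<exists>z\<in>P. d a z = t \<and> d z b \<le> d a b - t + e" if e: "e > 0" for e
  proof -
    obtain l where l: "poly_reach P a b l" "l < d a b + e"
      using gdist_approx[OF assms(1,2) e] by blast
    obtain K where K: "K \<subseteq> P" "connected K" "a \<in> K" "b \<in> K" "\<forall>z\<in>K. d a z + d z b \<le> l"
      using poly_reach_connected[OF l(1)] assms by blast
    have "connected (d a ` K)"
      using K continuous_on_gdist[OF \<open>a \<in> P\<close>] continuous_on_subset
      by (intro connected_continuous_image) blast+
    moreover have "d a a \<in> d a ` K" "d a b \<in> d a ` K"
      using K by auto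
    ultimately have "t \<in> d a ` K"
      using assms connected_contains_Icc[of "d a ` K" "d a a" "d a b"] gdist_self[of a] by auto
    then show ?thesis
      using K l by force
  qed
  let ?S = "{z \<in> P. d a z = t}"
  have "closed ?S"
    using continuous_closed_preimage_constant[OF continuous_on_gdist[OF \<open>a \<in> P\<close>] compact_imp_closed[OF compact]]
    by blast
  then have "compact ?S"
    using compact_Int_closed[OF compact, of ?S] by (simp add: Int_absorb1)
  moreover have "?S \<noteq> {}"
    using ex[of 1] by auto
  moreover have "continuous_on ?S (d b)"
    by (rule continuous_on_subset[OF continuous_on_gdist[OF \<open>b \<in> P\<close>]]) auto
  ultimately obtain z where z: "z \<in> ?S" "\<And>y. y \<in> ?S \<Longrightarrow> d b z \<le> d b y"
    using continuous_attains_inf[of ?S "d b"] by auto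
  have "d z b \<le> d a b - t"
  proof (rule field_le_epsilon)
    fix e :: real assume "0 < e"
    then show "d z b \<le> d a b - t + e"
      using ex[of e] z(2) gdist_commute[of P b] by force
  qed
  moreover have "d a b \<le> t + d z b"
    using gdist_triangle[of a z b] z assms by auto
  ultimately show ?thesis
    using that[of z] z by auto
qed

text \<open>A geodesic is a maximal subset of \<open>P\<close> on which \<open>d a\<close> is an isometry into \<open>[0, d a b]\<close>.
  Maximality makes it closed, and any gap could be filled with an intermediate point.\<close>
lemma geodesic_exists:
  assumes a: "a \<in> P" and b: "b \<in> P" and "a \<noteq> b"
  obtains g where "arc g" "pathstart g = a" "pathfinish g = b" "path_image g \<subseteq> P"
    "\<And>x. x \<in> path_image g \<Longrightarrow> d a x + d x b = d a b"
proof -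
  \<comment> \<open>The endpoints are inserted into the isometry condition instead of being required
    to lie in \<open>X\<close>: the empty set then qualifies, and a maximal set contains
    \<open>a\<close> and \<open>b\<close> automatically.\<close>
  define A where "A = {X. X \<subseteq> P \<and> (\<forall>x\<in>insert a (insert b X). \<forall>y\<in>insert a (insert b X). d x y = \<bar>d a x - d a y\<bar>)
    \<and> (\<forall>x\<in>X. d a x \<le> d a b)}"
  have "{} \<in> A"
    using a b gdist_nonneg[OF a b] by (auto simp: A_def gdist_self gdist_commute[of P b a])
  moreover have "\<Union>C \<in> A" if "C \<noteq> {}" "subset.chain A C" for C
  proof -
    have CA: "X \<in> A" if "X \<in> C" for X
      using that \<open>subset.chain A C\<close> by (auto simp: subset.chain_def)
    have "d x y = \<bar>d a x - d a y\<bar>" if xy: "x \<in> insert a (insert b (\<Union>C))" "y \<in> insert a (insert b (\<Union>C))" for x y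
    proof -
      obtain X where X: "X \<in> C" "x \<in> insert a (insert b X)"
        using xy(1) \<open>C \<noteq> {}\<close> by auto
      obtain Y where Y: "Y \<in> C" "y \<in> insert a (insert b Y)"
        using xy(2) \<open>C \<noteq> {}\<close> by auto
      have "X \<subseteq> Y \<or> Y \<subseteq> X"
        using X(1) Y(1) \<open>subset.chain A C\<close> by (auto simp: subset.chain_def)
      then obtain W where "W \<in> C" "x \<in> insert a (insert b W)" "y \<in> insert a (insert b W)"
        using X Y by blast
      then show ?thesis
        using CA[of W] by (auto simp: A_def)
    qed
    then show ?thesis
      using CA unfolding A_def by blast
  qed
  ultimately obtain M0 where M0: "M0 \<in> A" "\<And>X. X \<in> A \<Longrightarrow> M0 \<subseteq> X \<Longrightarrow> X = M0"
    using subset_Zorn_nonempty[of A] by blast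
  define M where "M = insert a (insert b M0)"
  have "M \<in> A"
    using M0(1) a b gdist_nonneg[OF a b] by (auto simp: A_def M_def gdist_self)
  then have "M = M0"
    using M0(2)[of M] by (auto simp: M_def)
  have ab: "a \<in> M" "b \<in> M"
    by (auto simp: M_def)
  have MP: "M \<subseteq> P" and iso: "\<And>x y. x \<in> M \<Longrightarrow> y \<in> M \<Longrightarrow> d x y = \<bar>d a x - d a y\<bar>"
    and le: "\<And>x. x \<in> M \<Longrightarrow> d a x \<le> d a b"
    using \<open>M \<in> A\<close> by (auto simp: A_def M_def)
  have maximal: "z \<in> M" if "z \<in> P" "d a z \<le> d a b" "\<And>x. x \<in> M \<Longrightarrow> d x z = \<bar>d a x - d a z\<bar>" for z
  proof -
    have "d x y = \<bar>d a x - d a y\<bar>" if "x \<in> insert z M" "y \<in> insert z M" for x y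
      using that iso[of x y] \<open>z \<in> P\<close> \<open>\<And>x. x \<in> M \<Longrightarrow> d x z = \<bar>d a x - d a z\<bar>\<close> gdist_self[of z]
        gdist_commute[of P z y] by (auto simp: abs_minus_commute)
    moreover have "insert a (insert b (insert z M)) = insert z M"
      using ab by auto
    ultimately have "\<forall>x\<in>insert a (insert b (insert z M)). \<forall>y\<in>insert a (insert b (insert z M)).
        d x y = \<bar>d a x - d a y\<bar>"
      by presburger
    then have "insert z M \<in> A"
      using MP le that(1,2) unfolding A_def by blast
    then show ?thesis
      using M0(2)[of "insert z M"] \<open>M = M0\<close> by auto
  qed
  have closed_M: "closed M"
    unfolding closed_sequential_limits
  proof (intro allI impI)
    fix f z assume f: "(\<forall>n. f n \<in> M) \<and> f \<longlonglongrightarrow> z"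
    have zP: "z \<in> P"
      using f MP compact_imp_closed[OF compact] closed_sequentially[of P f z] by auto
    have lim: "(\<lambda>n. d x (f n)) \<longlonglongrightarrow> d x z" if "x \<in> P" for x
      by (rule continuous_on_tendsto_compose[OF continuous_on_gdist[OF that]])
        (use f zP MP in \<open>auto intro!: always_eventually\<close>)
    show "z \<in> M"
    proof (rule maximal[OF zP])
      show "d a z \<le> d a b"
        using lim[OF a] f le by (intro LIMSEQ_le_const2[of "\<lambda>n. d a (f n)"]) auto
      fix x assume "x \<in> M"
      have "(\<lambda>n. \<bar>d a x - d a (f n)\<bar>) \<longlonglongrightarrow> \<bar>d a x - d a z\<bar>"
        by (intro tendsto_intros lim a)
      moreover have "(\<lambda>n. \<bar>d a x - d a (f n)\<bar>) = (\<lambda>n. d x (f n))"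
        using f \<open>x \<in> M\<close> iso by auto
      ultimately show "d x z = \<bar>d a x - d a z\<bar>"
        using lim[of x] \<open>x \<in> M\<close> MP LIMSEQ_unique by (metis subsetD)
    qed
  qed
  have cont: "continuous_on M (d a)"
    using continuous_on_gdist[OF a] MP continuous_on_subset by blast
  have "compact M"
    using closed_M compact MP compact_Int_closed[of P M] by (simp add: Int_absorb1)
  then have comp_img: "compact (d a ` M)"
    using cont compact_continuous_image by blast
  have onto: "t \<in> d a ` M" if "0 \<le> t" "t \<le> d a b" for t
  proof (rule ccontr)
    assume t: "t \<notin> d a ` M"
    have "compact (d a ` M \<inter> {..t})" "compact (d a ` M \<inter> {t..})"
      using comp_img by (auto intro!: compact_Int_closed)
    moreover have "d a ` M \<inter> {..t} \<noteq> {}" "d a ` M \<inter> {t..} \<noteq> {}"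
      using ab that gdist_self[OF a] by force+
    ultimately obtain t1 t2 where t1: "t1 \<in> d a ` M \<inter> {..t}" "\<And>s. s \<in> d a ` M \<inter> {..t} \<Longrightarrow> s \<le> t1"
      and t2: "t2 \<in> d a ` M \<inter> {t..}" "\<And>s. s \<in> d a ` M \<inter> {t..} \<Longrightarrow> t2 \<le> s"
      using compact_attains_sup[of "d a ` M \<inter> {..t}"] compact_attains_inf[of "d a ` M \<inter> {t..}"] by metis
    obtain x1 x2 where x1: "x1 \<in> M" "t1 = d a x1" and x2: "x2 \<in> M" "t2 = d a x2"
      using t1(1) t2(1) by auto
    have x12: "d x1 x2 = t2 - t1" "t1 \<le> t" "t \<le> t2"
      using iso[OF x1(1) x2(1)] x1 x2 t1(1) t2(1) by auto
    have xP: "x1 \<in> P" "x2 \<in> P"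
      using x1 x2 MP by auto
    then obtain z where z: "z \<in> P" "d x1 z = t - t1" "d z x2 = t2 - t"
      using gdist_intermediate[of x1 x2 "t - t1"] x12 by auto
    \<comment> \<open>The values \<open>t1\<close> and \<open>t2\<close> border the gap, so
      \<open>x\<close> lies beyond \<open>x1\<close> or beyond \<open>x2\<close>. The triangle
      inequality through the nearer of the two bounds \<open>d x z\<close> from above, the one
      towards the other bounds it from below.\<close>
    have dz: "d x z = \<bar>d a x - t\<bar>" if "x \<in> M" for x
    proof (cases "d a x \<le> t")
      case True
      then have "d a x \<le> t1"
        using t1(2) that by auto
      then have "d x x1 = t1 - d a x" "d x x2 = t2 - d a x"
        using iso[OF that] x1 x2 x12 by auto
      then show ?thesis
        using gdist_triangle[of x x1 z] gdist_triangle[of x z x2] that MP xP z True by auto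
    next
      case False
      then have "t2 \<le> d a x"
        using t2(2) that by auto
      then have "d x x2 = d a x - t2" "d x x1 = d a x - t1"
        using iso[OF that] x1 x2 x12 by auto
      then show ?thesis
        using gdist_triangle[of x x2 z] gdist_triangle[of x z x1] that MP xP z False
          gdist_commute[of P z x1] gdist_commute[of P z x2] by auto
    qed
    have "d a z = t"
      using dz[OF ab(1)] gdist_self[OF a] that by simp
    then have "z \<in> M"
      using maximal[OF z(1)] dz that by simp
    then show False
      using t \<open>d a z = t\<close> by auto
  qed
  have img: "d a ` M = {0..d a b}"
    using onto le gdist_nonneg[OF a] MP by auto
  have inj: "inj_on (d a) M"
    by (rule inj_onI) (use iso gdist_eq_0_iff MP in \<open>metis abs_zero diff_self subsetD\<close>)
  define L where "L = d a b"
  have "L > 0"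
    using gdist_nonneg[OF a b] gdist_eq_0_iff[OF a b] \<open>a \<noteq> b\<close> by (auto simp: L_def)
  \<comment> \<open>The inverse of \<open>d a\<close> on \<open>M\<close> is the parametrization by
    intrinsic arc length. It is 1-Lipschitz for the Euclidean distance because that distance never
    exceeds \<open>d\<close>; the factor \<open>L\<close> below rescales it to the unit
    interval.\<close>
  define \<gamma> where "\<gamma> = the_inv_into M (d a)"
  have \<gamma>: "\<gamma> s \<in> M" "d a (\<gamma> s) = s" if "0 \<le> s" "s \<le> L" for s
    using the_inv_into_into[OF inj, of s M] f_the_inv_into_f[OF inj, of s] img that
    by (auto simp: \<gamma>_def L_def)
  have scale: "0 \<le> L * s" "L * s \<le> L" if "s \<in> {0..1}" for s
    using that \<open>L > 0\<close> by (auto simp: mult_left_le)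
  have bij: "\<gamma> (d a x) = x" if "x \<in> M" for x
    using that inj by (simp add: \<gamma>_def the_inv_into_f_f)
  have "continuous_on {0..L} \<gamma>"
  proof -
    have "dist (\<gamma> s) (\<gamma> t) \<le> dist s t" if "s \<in> {0..L}" "t \<in> {0..L}" for s t
      using dist_le_gdist[of "\<gamma> s" "\<gamma> t"] iso[of "\<gamma> s" "\<gamma> t"] \<gamma>[of s] \<gamma>[of t] that MP
      by (auto simp: dist_real_def)
    then show ?thesis
      unfolding continuous_on_iff by (meson order.strict_trans1)
  qed
  then have "continuous_on {0..1} (\<lambda>s. \<gamma> (L * s))"
    by (rule continuous_on_compose2) (use scale in \<open>auto intro!: continuous_intros\<close>)
  moreover have "inj_on (\<lambda>s. \<gamma> (L * s)) {0..1}"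
  proof (rule inj_onI)
    fix s t assume "s \<in> {0..1}" "t \<in> {0..1}" "\<gamma> (L * s) = \<gamma> (L * t)"
    then have "L * s = L * t"
      using \<gamma>(2)[OF scale] by metis
    then show "s = t"
      using \<open>L > 0\<close> by simp
  qed
  ultimately have "arc (\<lambda>s. \<gamma> (L * s))"
    by (simp add: arc_def path_def)
  moreover have sub: "path_image (\<lambda>s. \<gamma> (L * s)) \<subseteq> M"
    using \<gamma>(1) scale by (auto simp: path_image_def)
  moreover have "d a x + d x b = d a b" if "x \<in> M" for x
    using iso[OF that ab(2)] le[OF that] by simp
  ultimately show thesis
    using that[of "\<lambda>s. \<gamma> (L * s)"] MP bij[OF ab(1)] bij[OF ab(2)] gdist_self[OF a]
    by (auto simp: pathstart_def pathfinish_def L_def)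
qed

end

subsection \<open>Nonplanarity of \<open>K\<^sub>3\<^sub>,\<^sub>3\<close>\<close>

lemma arc_image_minus_start:
  assumes "arc g"
  shows "connected (path_image g - {pathstart g})"
    and "pathstart g \<in> closure (path_image g - {pathstart g})"
proof -
  have inj: "inj_on g {0..1}" and cont: "continuous_on {0..1} g"
    using assms by (auto simp: arc_def path_def)
  have eq: "path_image g - {pathstart g} = g ` {0<..1}"
    proof -
    have "{0..1} = insert 0 {0<..1::real}"
      by auto
    then have "g ` {0..1} - {g 0} = g ` {0<..1} - {g 0}"
      by auto
    also have "\<dots> = g ` {0<..1}"
      by (auto dest!: inj_onD[OF inj])
    finally show ?thesis
      by (simp add: path_image_def pathstart_def)
  qed
  show "connected (path_image g - {pathstart g})"
    unfolding eq by (intro connected_continuous_image continuous_on_subset[OF cont]) auto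
  have "g ` {0..1} \<subseteq> closure (g ` {0<..1})"
    using image_closure_subset[of "{0<..1}" g, OF _ closed_closure closure_subset] cont by simp
  then show "pathstart g \<in> closure (path_image g - {pathstart g})"
    unfolding eq by (auto simp: pathstart_def)
qed

lemma arc_image_minus_finish:
  assumes "arc g"
  shows "connected (path_image g - {pathfinish g})"
    and "pathfinish g \<in> closure (path_image g - {pathfinish g})"
  using arc_image_minus_start[of "reversepath g"] assms by (simp_all add: arc_reversepath)

text \<open>If the chords \<open>K\<close> and \<open>Z\<close> lay on the same side of the closed curve, the other side \<open>D\<close>
  could be joined to \<open>Z\<close> through \<open>y\<close> avoiding \<open>c1 \<union> K\<close>, and through \<open>x\<close> avoiding \<open>c2 \<union> K\<close>;
  Janiszewski's theorem would then join \<open>D\<close> to \<open>Z\<close> avoiding the curve.\<close>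
lemma interleaved_chords_same_side:
  fixes c1 c2 :: "real \<Rightarrow> complex"
  assumes "arc c1" "arc c2" "pathstart c1 = u" "pathstart c2 = u" "pathfinish c1 = v" "pathfinish c2 = v"
    and c12: "path_image c1 \<inter> path_image c2 = {u, v}"
    and K: "compact K" "connected K" "u \<in> K" "v \<in> K"
    and Z: "connected Z" "Z \<inter> K = {}"
    and x: "x \<in> path_image c1" "x \<in> closure Z" "x \<notin> path_image c2" "x \<notin> K"
    and y: "y \<in> path_image c2" "y \<in> closure Z" "y \<notin> path_image c1" "y \<notin> K"
    and N: "connected N" "N \<inter> (path_image c1 \<union> path_image c2) = {}" "K - {u, v} \<subseteq> N" "Z \<subseteq> N"
  shows False
proof -
  let ?C = "path_image c1 \<union> path_image c2"
  let ?c = "c1 +++ reversepath c2"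
  have sp: "simple_path ?c"
    using assms by (intro simple_path_join_loop) (auto simp: arc_reversepath)
  have im: "path_image ?c = ?C"
    using assms by (simp add: path_image_join)
  have "pathfinish ?c = pathstart ?c"
    using assms by simp
  note J = Jordan_inside_outside[OF sp this, unfolded im]
  obtain q where q: "q \<in> Z"
    using x(2) by fastforce
  have Nc: "connected_component (- ?C) q z" if "z \<in> N" for z
    using N q that by (auto simp: connected_component_def intro!: exI[of _ N])
  have "q \<in> inside ?C \<or> q \<in> outside ?C"
    using N q inside_Un_outside[of ?C] by blast
  \<comment> \<open>\<open>D\<close> is the face of the Jordan curve that misses \<open>N\<close>.
    Its frontier is the whole curve, so it can be extended by any point of the curve and remain
    connected.\<close>
  then obtain D where D: "D \<noteq> {}" "connected D" "frontier D = ?C" "D \<inter> ?C = {}" "D \<inter> N = {}"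
    and Dq: "\<And>p. p \<in> D \<Longrightarrow> \<not> connected_component (- ?C) p q"
  proof
    assume q_in: "q \<in> inside ?C"
    then have "N \<subseteq> inside ?C"
      using Nc inside_same_component by blast
    then have "outside ?C \<inter> N = {}"
      using inside_Int_outside[of ?C] by blast
    moreover have "\<not> connected_component (- ?C) p q" if "p \<in> outside ?C" for p
      using outside_same_component[OF _ that, of q] q_in inside_Int_outside[of ?C] by blast
    ultimately show ?thesis
      using J outside_no_overlap[of ?C] that[of "outside ?C"] by simp
  next
    assume q_out: "q \<in> outside ?C"
    then have "N \<subseteq> outside ?C"
      using Nc outside_same_component by blast
    then have "inside ?C \<inter> N = {}"
      using inside_Int_outside[of ?C] by blast
    moreover have "\<not> connected_component (- ?C) p q" if "p \<in> inside ?C" for p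
      using inside_same_component[OF _ that, of q] q_out inside_Int_outside[of ?C] by blast
    ultimately show ?thesis
      using J inside_no_overlap[of ?C] that[of "inside ?C"] by simp
  qed
  obtain p where p: "p \<in> D"
    using D by blast
  \<comment> \<open>A point \<open>w\<close> of the curve in the closure of both \<open>D\<close>
    and \<open>Z\<close> glues them together, and \<open>w\<close> is the only point of the curve on
    the resulting connected set.\<close>
  have joined: "connected_component (- S) p q"
    if "w \<in> ?C" "w \<in> closure Z" "w \<notin> S" "S \<subseteq> ?C \<union> K" for w S
  proof -
    have "w \<in> closure D"
      using D that by (metis DiffD1 frontier_def)
    then have "connected (insert w D)"
      using D(2) closure_subset connected_intermediate_closure[of D "insert w D"] by auto
    moreover have "connected (insert w Z)"
      using Z(1) that closure_subset connected_intermediate_closure[of Z "insert w Z"] by auto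
    ultimately have "connected (insert w D \<union> insert w Z)"
      by (intro connected_Un) auto
    moreover have "insert w D \<union> insert w Z \<subseteq> - S"
      using that D N Z c12 by blast
    ultimately show ?thesis
      using p q by (auto simp: connected_component_def intro!: exI[of _ "insert w D \<union> insert w Z"])
  qed
  have "connected_component (- (path_image c1 \<union> K)) p q"
    by (rule joined[of y]) (use y in auto)
  moreover have "connected_component (- (path_image c2 \<union> K)) p q"
    by (rule joined[of x]) (use x in auto)
  \<comment> \<open>Janiszewski's theorem needs a connected intersection. Here it is
    \<open>K\<close>, since the two common points of the arcs are the ends of the chord.\<close>
  moreover have "(path_image c1 \<union> K) \<inter> (path_image c2 \<union> K) = K"
    using c12 K(3,4) by auto
  ultimately have "connected_component (- ((path_image c1 \<union> K) \<union> (path_image c2 \<union> K))) p q"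
    by - (rule Janiszewski,
      simp_all add: K \<open>arc c1\<close> \<open>arc c2\<close> compact_Un compact_arc_image compact_imp_closed)
  then have "connected_component (- ?C) p q"
    by (rule connected_component_of_subset) auto
  with Dq[OF p] show False
    by blast
qed

text \<open>The four edges between \<open>p i1\<close>, \<open>p i2\<close> and \<open>q j1\<close>,
  \<open>q j2\<close> form a closed curve. The path through \<open>p i3\<close> joins
  \<open>q j1\<close> to \<open>q j2\<close>, the path through \<open>q j3\<close> joins
  \<open>p i1\<close> to \<open>p i2\<close>, and these ends alternate on the curve. The remaining
  edge \<open>E i3 j3\<close> connects the two paths off the curve, which forces them onto the same
  side.\<close>

theorem K33_not_planar:
  fixes E :: "'i \<Rightarrow> 'j \<Rightarrow> real \<Rightarrow> complex"
  assumes "card I = 3" "card J = 3"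
    and arcE: "\<And>i j. i \<in> I \<Longrightarrow> j \<in> J \<Longrightarrow> arc (E i j)"
    and startE: "\<And>i j. i \<in> I \<Longrightarrow> j \<in> J \<Longrightarrow> pathstart (E i j) = p i"
    and finishE: "\<And>i j. i \<in> I \<Longrightarrow> j \<in> J \<Longrightarrow> pathfinish (E i j) = q j"
    and disj: "\<And>i j k l. i \<in> I \<Longrightarrow> j \<in> J \<Longrightarrow> k \<in> I \<Longrightarrow> l \<in> J \<Longrightarrow> i \<noteq> k \<Longrightarrow> j \<noteq> l \<Longrightarrow>
        path_image (E i j) \<inter> path_image (E k l) = {}"
    and adj_p: "\<And>i j l. i \<in> I \<Longrightarrow> j \<in> J \<Longrightarrow> l \<in> J \<Longrightarrow> j \<noteq> l \<Longrightarrow>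
        path_image (E i j) \<inter> path_image (E i l) \<subseteq> {p i}"
    and adj_q: "\<And>i j k. i \<in> I \<Longrightarrow> j \<in> J \<Longrightarrow> k \<in> I \<Longrightarrow> i \<noteq> k \<Longrightarrow>
        path_image (E i j) \<inter> path_image (E k j) \<subseteq> {q j}"
  shows False
proof -
  obtain i1 i2 i3 where I: "I = {i1, i2, i3}" "i1 \<noteq> i2" "i1 \<noteq> i3" "i2 \<noteq> i3"
    using \<open>card I = 3\<close> by (auto simp: card_3_iff)
  obtain j1 j2 j3 where J: "J = {j1, j2, j3}" "j1 \<noteq> j2" "j1 \<noteq> j3" "j2 \<noteq> j3"
    using \<open>card J = 3\<close> by (auto simp: card_3_iff)
  let ?e = "\<lambda>i j. path_image (E i j)"
  have p_in: "p i \<in> ?e i j" if "i \<in> I" "j \<in> J" for i j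
    using startE[OF that] pathstart_in_path_image by metis
  have q_in: "q j \<in> ?e i j" if "i \<in> I" "j \<in> J" for i j
    using finishE[OF that] pathfinish_in_path_image by metis
  have pq: "p i \<noteq> q j" if "i \<in> I" "j \<in> J" for i j
    using startE[OF that] finishE[OF that] arcE[OF that] arc_distinct_ends by metis
  have p_out: "p i \<notin> ?e k j" if "i \<in> I" "j \<in> J" "k \<in> I" "i \<noteq> k" for i j k
    using adj_q[of i j k] p_in[of i j] pq[of i j] that by auto
  have conn: "connected (?e i j)" "compact (?e i j)" if "i \<in> I" "j \<in> J" for i j
    using arcE[OF that] by (auto simp: connected_arc_image compact_arc_image)
  have start: "connected (?e i j - {p i})" "p i \<in> closure (?e i j - {p i})"
    and finish: "connected (?e i j - {q j})" if "i \<in> I" "j \<in> J" for i j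
    using arc_image_minus_start[OF arcE[OF that]] arc_image_minus_finish[OF arcE[OF that]]
      startE[OF that] finishE[OF that] by simp_all
  define c where "c = (\<lambda>i. reversepath (E i j1) +++ E i j2)"
  have c: "arc (c i)" "pathstart (c i) = q j1" "pathfinish (c i) = q j2"
    "path_image (c i) = ?e i j1 \<union> ?e i j2" if "i \<in> I" for i
    using that J startE[of i] finishE[of i] arcE[of i] adj_p[of i j1 j2]
    by (auto simp: c_def path_image_join arc_reversepath intro!: arc_join)
  define K where "K = ?e i3 j1 \<union> ?e i3 j2"
  define Z where "Z = (?e i1 j3 - {p i1}) \<union> (?e i2 j3 - {p i2})"
  \<comment> \<open>Both chords without their ends on the curve, linked by the edge
    \<open>E i3 j3\<close>; the connectedness of this set is what places them on one side.\<close>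
  define N where "N = ((?e i3 j1 - {q j1}) \<union> (?e i3 j2 - {q j2})) \<union> ?e i3 j3 \<union> Z"
  have [simp]: "i1 \<in> I" "i2 \<in> I" "i3 \<in> I" "j1 \<in> J" "j2 \<in> J" "j3 \<in> J"
    using I J by auto
  note [simp] = I(2-4) J(2-4) I(2-4)[symmetric] J(2-4)[symmetric]
  have Zc: "connected Z"
    unfolding Z_def
  proof (rule connected_Un)
    have "q j3 \<in> (?e i1 j3 - {p i1}) \<inter> (?e i2 j3 - {p i2})"
      by (simp add: q_in pq[symmetric])
    then show "(?e i1 j3 - {p i1}) \<inter> (?e i2 j3 - {p i2}) \<noteq> {}"
      by blast
  qed (simp_all add: start)
  have Nc: "connected N"
    unfolding N_def
  proof (intro connected_Un)
    have "p i3 \<in> (?e i3 j1 - {q j1}) \<inter> (?e i3 j2 - {q j2})" "p i3 \<in> ?e i3 j3"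
      by (simp_all add: p_in pq)
    then show "(?e i3 j1 - {q j1}) \<inter> (?e i3 j2 - {q j2}) \<noteq> {}"
      "(?e i3 j1 - {q j1} \<union> (?e i3 j2 - {q j2})) \<inter> ?e i3 j3 \<noteq> {}"
      by blast+
    have "q j3 \<in> Z" "q j3 \<in> ?e i3 j3"
      by (simp_all add: Z_def q_in pq[symmetric])
    then show "(?e i3 j1 - {q j1} \<union> (?e i3 j2 - {q j2}) \<union> ?e i3 j3) \<inter> Z \<noteq> {}"
      by blast
  qed (simp_all add: Zc finish conn)
  have c12: "path_image (c i1) \<inter> path_image (c i2) = {q j1, q j2}"
  proof
    show "path_image (c i1) \<inter> path_image (c i2) \<subseteq> {q j1, q j2}"
      using adj_q[of i1 j1 i2] adj_q[of i1 j2 i2] disj[of i1 j1 i2 j2] disj[of i1 j2 i2 j1]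
      by (simp add: c(4)) blast
    show "{q j1, q j2} \<subseteq> path_image (c i1) \<inter> path_image (c i2)"
      by (simp add: c(4) q_in)
  qed
  have K: "compact K" "connected K"
  proof -
    have "p i3 \<in> ?e i3 j1 \<inter> ?e i3 j2"
      by (simp add: p_in)
    then show "connected K"
      unfolding K_def by (intro connected_Un) (auto simp: conn)
  qed (simp add: K_def conn compact_Un)
  have ZK: "Z \<inter> K = {}"
    using disj[of i1 j3 i3 j1] disj[of i1 j3 i3 j2] disj[of i2 j3 i3 j1] disj[of i2 j3 i3 j2]
    unfolding Z_def K_def by simp blast
  have cl: "p i1 \<in> closure Z" "p i2 \<in> closure Z"
    using start(2)[of i1 j3] start(2)[of i2 j3] unfolding Z_def closure_Un by simp_all
  have N_disj: "N \<inter> path_image (c i) = {}" if "i \<in> {i1, i2}" for i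
  proof -
    have [simp]: "i \<in> I" "i \<noteq> i3" "i3 \<noteq> i"
      using that by auto
    have "(?e i3 j1 - {q j1}) \<inter> path_image (c i) = {}"
      using adj_q[of i3 j1 i] disj[of i3 j1 i j2] by (simp add: c(4)) blast
    moreover have "(?e i3 j2 - {q j2}) \<inter> path_image (c i) = {}"
      using adj_q[of i3 j2 i] disj[of i3 j2 i j1] by (simp add: c(4)) blast
    moreover have "?e i3 j3 \<inter> path_image (c i) = {}"
      using disj[of i3 j3 i j1] disj[of i3 j3 i j2] by (simp add: c(4)) blast
    moreover have "(?e k j3 - {p k}) \<inter> path_image (c i) = {}" if "k \<in> I" for k
    proof (cases "k = i")
      case True
      then show ?thesis
        using adj_p[of i j3 j1] adj_p[of i j3 j2] by (simp add: c(4)) blast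
    next
      case False
      then show ?thesis
        using that disj[of k j3 i j1] disj[of k j3 i j2] by (simp add: c(4)) blast
    qed
    ultimately show ?thesis
      unfolding N_def Z_def by (simp add: Int_Un_distrib2)
  qed
  show False
  proof (rule interleaved_chords_same_side[OF _ _ _ _ _ _ c12 K _ _ Zc ZK _ cl(1) _ _ _ cl(2) _ _ Nc])
    show "N \<inter> (path_image (c i1) \<union> path_image (c i2)) = {}"
      using N_disj[of i1] N_disj[of i2] by auto
    show "K - {q j1, q j2} \<subseteq> N" "Z \<subseteq> N"
      by (auto simp: K_def N_def)
    show "p i1 \<notin> K" "p i2 \<notin> K" "q j1 \<in> K" "q j2 \<in> K"
      using p_out q_in by (simp_all add: K_def)
    show "p i1 \<in> path_image (c i1)" "p i1 \<notin> path_image (c i2)"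
      "p i2 \<in> path_image (c i2)" "p i2 \<notin> path_image (c i1)"
      using p_in p_out by (simp_all add: c(4))
  qed (simp_all add: c(1-3))
qed

section \<open>Tripods inside stars of arcs\<close>

text \<open>Take an arc from \<open>c1\<close> to \<open>c2\<close> that avoids \<open>c3\<close>,
  and follow a path from \<open>c3\<close> to an interior point of that arc, avoiding
  \<open>c1\<close> and \<open>c2\<close>, up to its first contact \<open>m\<close>.
  Path-connectedness after deletion of the ends is what keeps \<open>m\<close> away from all three
  of them.\<close>

lemma path_connected_contains_tripod:
  fixes T :: "complex set"
  assumes pc: "\<And>X. X \<subseteq> {c1, c2, c3} \<Longrightarrow> path_connected (T - X)"
    and cT: "c1 \<in> T" "c2 \<in> T" "c3 \<in> T" and dist: "c1 \<noteq> c2" "c1 \<noteq> c3" "c2 \<noteq> c3"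
  obtains m h1 h2 h3 where "m \<notin> {c1, c2, c3}" "arc h1" "arc h2" "arc h3"
    "pathstart h1 = m" "pathstart h2 = m" "pathstart h3 = m"
    "pathfinish h1 = c1" "pathfinish h2 = c2" "pathfinish h3 = c3"
    "path_image h1 \<subseteq> T" "path_image h2 \<subseteq> T" "path_image h3 \<subseteq> T"
    "path_image h1 \<inter> path_image h2 \<subseteq> {m}" "path_image h1 \<inter> path_image h3 \<subseteq> {m}"
    "path_image h2 \<inter> path_image h3 \<subseteq> {m}"
proof -
  obtain \<alpha> where \<alpha>: "arc \<alpha>" "path_image \<alpha> \<subseteq> T - {c3}" "pathstart \<alpha> = c1" "pathfinish \<alpha> = c2"
    using pc[of "{c3}"] cT dist unfolding path_connected_arcwise by blast
  have inj: "inj_on \<alpha> {0..1}" and "path \<alpha>"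
    using \<alpha> by (auto simp: arc_def)
  have ends: "\<alpha> 0 = c1" "\<alpha> 1 = c2"
    using \<alpha> by (auto simp: pathstart_def pathfinish_def)
  have mid: "\<alpha> (1/2) \<in> path_image \<alpha>" "\<alpha> (1/2) \<noteq> c1" "\<alpha> (1/2) \<noteq> c2"
    using inj unfolding ends[symmetric] by (auto simp: path_image_def inj_on_eq_iff)
  obtain g where g: "path g" "path_image g \<subseteq> T - {c1, c2}" "pathstart g = c3" "pathfinish g = \<alpha> (1/2)"
    using pc[of "{c1, c2}"] cT dist mid \<alpha> unfolding path_connected_def by blast
  have cl: "closed (path_image \<alpha>)"
    using \<alpha> closed_arc_image by blast
  have "c3 \<notin> path_image \<alpha>"
    using \<alpha> by auto
  obtain h where h: "path h" "pathstart h = c3" "path_image h \<subseteq> path_image g"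
    "path_image h - {pathfinish h} \<subseteq> interior (- path_image \<alpha>)"
    "pathfinish h \<in> frontier (- path_image \<alpha>)"
    using exists_path_subpath_to_frontier[of g "- path_image \<alpha>"] g mid \<open>c3 \<notin> path_image \<alpha>\<close>
      closure_subset by (metis ComplI Compl_iff subsetD)
  define m where "m = pathfinish h"
  have m\<alpha>: "m \<in> path_image \<alpha>"
    using h(5) frontier_subset_eq[of "path_image \<alpha>"] cl by (auto simp: m_def)
  have mh: "m \<in> path_image h"
    unfolding m_def by (rule pathfinish_in_path_image)
  have m: "m \<notin> {c1, c2, c3}"
    using mh m\<alpha> h(3) g(2) \<alpha>(2) by auto
  obtain h' where h': "arc h'" "path_image h' \<subseteq> path_image h" "pathstart h' = c3" "pathfinish h' = m"
    using path_contains_arc[OF h(1,2) m_def[symmetric]] m by blast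
  have h\<alpha>: "path_image h \<inter> path_image \<alpha> \<subseteq> {m}"
    using h(4) interior_subset by (fastforce simp: m_def)
  obtain t where t: "0 \<le> t" "t \<le> 1" "m = \<alpha> t"
    using m\<alpha> by (auto simp: path_image_def)
  then have t01: "t \<noteq> 0" "t \<noteq> 1"
    using m ends by auto
  have sub: "path_image (subpath 0 t \<alpha>) \<subseteq> path_image \<alpha>" "path_image (subpath t 1 \<alpha>) \<subseteq> path_image \<alpha>"
    using t by (simp_all add: path_image_subpath_subset)
  have sub_arc: "arc (subpath 0 t \<alpha>)" "arc (subpath t 1 \<alpha>)"
    using t t01 \<alpha> by (auto intro!: arc_subpath_arc)
  show thesis
  proof (rule that[of m "reversepath (subpath 0 t \<alpha>)" "subpath t 1 \<alpha>" "reversepath h'"])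
    show "path_image (reversepath (subpath 0 t \<alpha>)) \<inter> path_image (subpath t 1 \<alpha>) \<subseteq> {m}"
      using t inj by (auto simp: path_image_subpath) (metis atLeastAtMost_iff inj_on_eq_iff order.trans order_antisym)
  qed (use m t sub_arc h' h\<alpha> sub \<alpha> h(3) g(2) ends in \<open>auto simp: arc_reversepath\<close>)
qed

text \<open>A surviving point is reached from \<open>a\<close> along its own arc before that arc
  arrives at its end, and the ends of the other arcs do not lie on it.\<close>

lemma path_connected_star_of_arcs:
  fixes g :: "'j \<Rightarrow> real \<Rightarrow> 'a::real_normed_vector"
  assumes arcs: "\<And>j. j \<in> J \<Longrightarrow> arc (g j)"
    and start: "\<And>j. j \<in> J \<Longrightarrow> pathstart (g j) = a"
    and finish: "\<And>j. j \<in> J \<Longrightarrow> pathfinish (g j) = c j"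
    and out: "\<And>j k. j \<in> J \<Longrightarrow> k \<in> J \<Longrightarrow> j \<noteq> k \<Longrightarrow> c k \<notin> path_image (g j)"
    and X: "X \<subseteq> c ` J"
  shows "path_connected ((\<Union>j\<in>J. path_image (g j)) - X)" (is "path_connected ?T")
proof -
  have "path_component ?T a x" if x: "x \<in> ?T" for x
  proof -
    obtain j where j: "j \<in> J" "x \<in> path_image (g j)"
      using x by auto
    then obtain t where t: "t \<in> {0..1}" "x = g j t"
      by (auto simp: path_image_def)
    have inj: "inj_on (g j) {0..1}" and fin: "c j = g j 1"
      using arcs[OF j(1)] finish[OF j(1)] by (auto simp: arc_def pathfinish_def)
    have "g j s \<notin> X" if s: "0 \<le> s" "s \<le> t" for s
    proof
      assume "g j s \<in> X"
      then obtain k where k: "k \<in> J" "g j s = c k"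
        using X by auto
      then have "k = j"
        using out[OF j(1) k(1)] s t by (force simp: path_image_def)
      then have "s = 1"
        using k(2) fin inj_onD[OF inj, of s 1] s t by auto
      then show False
        using \<open>g j s \<in> X\<close> s t x by auto
    qed
    then have "path_image (subpath 0 t (g j)) \<subseteq> ?T"
      using t j path_image_subpath_subset[of 0 t "g j"] by (auto simp: path_image_subpath)
    moreover have "path (subpath 0 t (g j))"
      using arcs[OF j(1)] t by (auto simp: arc_imp_path intro!: path_subpath)
    moreover have "pathstart (subpath 0 t (g j)) = a" "pathfinish (subpath 0 t (g j)) = x"
      using start[OF j(1)] t by (simp_all add: pathstart_def subpath_def pathfinish_def)
    ultimately show ?thesis
      unfolding path_component_def by blast
  qed
  then show ?thesis
    unfolding path_connected_component by (meson path_component_sym path_component_trans)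
qed

text \<open>Arcs of a star may intersect each other in any way, as long as no arc passes through the
  end of another. The tripod keeps the three ends; its hub \<open>m\<close> may differ from
  \<open>a\<close>.\<close>

lemma star_of_arcs_contains_tripod:
  fixes g :: "'j \<Rightarrow> real \<Rightarrow> complex"
  assumes "card J = 3"
    and arcs: "\<And>j. j \<in> J \<Longrightarrow> arc (g j)"
    and start: "\<And>j. j \<in> J \<Longrightarrow> pathstart (g j) = a"
    and finish: "\<And>j. j \<in> J \<Longrightarrow> pathfinish (g j) = c j"
    and out: "\<And>j k. j \<in> J \<Longrightarrow> k \<in> J \<Longrightarrow> j \<noteq> k \<Longrightarrow> c k \<notin> path_image (g j)"
  shows "\<exists>m h. m \<notin> c ` J \<and>
    (\<forall>j\<in>J. arc (h j) \<and> pathstart (h j) = m \<and> pathfinish (h j) = c j \<and>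
      path_image (h j) \<subseteq> (\<Union>j\<in>J. path_image (g j)) \<and>
      (\<forall>k\<in>J. j \<noteq> k \<longrightarrow> path_image (h j) \<inter> path_image (h k) \<subseteq> {m}))"
proof -
  obtain j1 j2 j3 where J: "J = {j1, j2, j3}" "j1 \<noteq> j2" "j1 \<noteq> j3" "j2 \<noteq> j3"
    using \<open>card J = 3\<close> by (auto simp: card_3_iff)
  let ?T = "\<Union>j\<in>J. path_image (g j)"
  have c_in: "c j \<in> path_image (g j)" if "j \<in> J" for j
    using finish[OF that] pathfinish_in_path_image by metis
  then have neq: "c j \<noteq> c k" if "j \<in> J" "k \<in> J" "j \<noteq> k" for j k
    using out that by metis
  have "path_connected (?T - X)" if "X \<subseteq> {c j1, c j2, c j3}" for X
    by (rule path_connected_star_of_arcs[OF arcs start finish out]) (use that J in auto)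
  moreover have "c j1 \<in> ?T" "c j2 \<in> ?T" "c j3 \<in> ?T"
    using c_in J by auto
  moreover have "c j1 \<noteq> c j2" "c j1 \<noteq> c j3" "c j2 \<noteq> c j3"
    using neq J by auto
  ultimately obtain m h1 h2 h3 where m: "m \<notin> {c j1, c j2, c j3}" and h: "arc h1" "arc h2" "arc h3"
    "pathstart h1 = m" "pathstart h2 = m" "pathstart h3 = m"
    "pathfinish h1 = c j1" "pathfinish h2 = c j2" "pathfinish h3 = c j3"
    "path_image h1 \<subseteq> ?T" "path_image h2 \<subseteq> ?T" "path_image h3 \<subseteq> ?T"
    and disj: "path_image h1 \<inter> path_image h2 \<subseteq> {m}" "path_image h1 \<inter> path_image h3 \<subseteq> {m}"
    "path_image h2 \<inter> path_image h3 \<subseteq> {m}"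
    by (rule path_connected_contains_tripod)
  let ?h = "\<lambda>j. if j = j1 then h1 else if j = j2 then h2 else h3"
  have "m \<notin> c ` J"
    using m J(1) by auto
  moreover have "arc (?h j) \<and> pathstart (?h j) = m \<and> pathfinish (?h j) = c j \<and> path_image (?h j) \<subseteq> ?T"
    if "j \<in> J" for j
    using that h J(2-4) unfolding J(1) by fastforce
  moreover have "path_image (?h j) \<inter> path_image (?h k) \<subseteq> {m}" if "j \<in> J" "k \<in> J" "j \<noteq> k" for j k
    using that disj J(2-4) unfolding J(1) by auto
  ultimately show ?thesis
    by (intro exI[of _ m] exI[of _ ?h]) blast
qed

text \<open>No condition separates two arcs that leave the same point. Each star is replaced by a
  tripod within its union, and the legs that share the end \<open>c i j\<close> are joined there to
  an edge between the hubs \<open>m i\<close> and \<open>n j\<close>. Legs of different stars stay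
  apart because the stars of \<open>a i\<close> and \<open>b j\<close> meet at most in
  \<open>c i j\<close>.\<close>

lemma K33_stars_not_planar:
  fixes \<gamma> \<delta> :: "'i \<Rightarrow> 'j \<Rightarrow> real \<Rightarrow> complex"
  assumes I: "card I = 3" and J: "card J = 3"
    and \<gamma>: "\<And>i j. i \<in> I \<Longrightarrow> j \<in> J \<Longrightarrow> arc (\<gamma> i j) \<and> pathstart (\<gamma> i j) = a i \<and> pathfinish (\<gamma> i j) = c i j"
    and \<delta>: "\<And>i j. i \<in> I \<Longrightarrow> j \<in> J \<Longrightarrow> arc (\<delta> i j) \<and> pathstart (\<delta> i j) = b j \<and> pathfinish (\<delta> i j) = c i j"
    and \<gamma>\<gamma>: "\<And>i j k l. i \<in> I \<Longrightarrow> j \<in> J \<Longrightarrow> k \<in> I \<Longrightarrow> l \<in> J \<Longrightarrow> i \<noteq> k \<Longrightarrow>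
      path_image (\<gamma> i j) \<inter> path_image (\<gamma> k l) = {}"
    and \<delta>\<delta>: "\<And>i j k l. i \<in> I \<Longrightarrow> j \<in> J \<Longrightarrow> k \<in> I \<Longrightarrow> l \<in> J \<Longrightarrow> j \<noteq> l \<Longrightarrow>
      path_image (\<delta> i j) \<inter> path_image (\<delta> k l) = {}"
    and \<gamma>\<delta>: "\<And>i j k l. i \<in> I \<Longrightarrow> j \<in> J \<Longrightarrow> k \<in> I \<Longrightarrow> l \<in> J \<Longrightarrow> (i, j) \<noteq> (k, l) \<Longrightarrow>
      path_image (\<gamma> i j) \<inter> path_image (\<delta> k l) = {}"
    and meet: "\<And>i j. i \<in> I \<Longrightarrow> j \<in> J \<Longrightarrow> path_image (\<gamma> i j) \<inter> path_image (\<delta> i j) \<subseteq> {c i j}"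
  shows False
proof -
  let ?T = "\<lambda>i. \<Union>j\<in>J. path_image (\<gamma> i j)" and ?U = "\<lambda>j. \<Union>i\<in>I. path_image (\<delta> i j)"
  have c\<gamma>: "c i j \<in> path_image (\<gamma> i j)" and c\<delta>: "c i j \<in> path_image (\<delta> i j)" if "i \<in> I" "j \<in> J" for i j
    using \<gamma>[OF that] \<delta>[OF that] pathfinish_in_path_image by metis+
  have c_out: "c i l \<notin> path_image (\<gamma> i j)" if "i \<in> I" "j \<in> J" "l \<in> J" "j \<noteq> l" for i j l
    using \<gamma>\<delta>[of i j i l] c\<delta>[of i l] that by auto
  have c_out': "c k j \<notin> path_image (\<delta> i j)" if "i \<in> I" "j \<in> J" "k \<in> I" "i \<noteq> k" for i j k
    using \<gamma>\<delta>[of k j i j] c\<gamma>[of k j] that by auto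
  have "\<exists>m h. m \<notin> c i ` J \<and>
    (\<forall>j\<in>J. arc (h j) \<and> pathstart (h j) = m \<and> pathfinish (h j) = c i j \<and> path_image (h j) \<subseteq> ?T i \<and>
      (\<forall>k\<in>J. j \<noteq> k \<longrightarrow> path_image (h j) \<inter> path_image (h k) \<subseteq> {m}))" if "i \<in> I" for i
    by (rule star_of_arcs_contains_tripod[OF J, where a = "a i"])
      (use \<gamma> that c_out in auto)
  then obtain m h where h0: "\<And>i. i \<in> I \<Longrightarrow> m i \<notin> c i ` J \<and>
    (\<forall>j\<in>J. arc (h i j) \<and> pathstart (h i j) = m i \<and> pathfinish (h i j) = c i j \<and> path_image (h i j) \<subseteq> ?T i \<and>
      (\<forall>k\<in>J. j \<noteq> k \<longrightarrow> path_image (h i j) \<inter> path_image (h i k) \<subseteq> {m i}))"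
    by metis
  have "\<exists>n h. n \<notin> (\<lambda>i. c i j) ` I \<and>
    (\<forall>i\<in>I. arc (h i) \<and> pathstart (h i) = n \<and> pathfinish (h i) = c i j \<and> path_image (h i) \<subseteq> ?U j \<and>
      (\<forall>k\<in>I. i \<noteq> k \<longrightarrow> path_image (h i) \<inter> path_image (h k) \<subseteq> {n}))" if "j \<in> J" for j
    by (rule star_of_arcs_contains_tripod[OF I, where a = "b j"])
      (use \<delta> that c_out' in auto)
  then obtain n k where k0: "\<And>j. j \<in> J \<Longrightarrow> n j \<notin> (\<lambda>i. c i j) ` I \<and>
    (\<forall>i\<in>I. arc (k j i) \<and> pathstart (k j i) = n j \<and> pathfinish (k j i) = c i j \<and> path_image (k j i) \<subseteq> ?U j \<and>
      (\<forall>l\<in>I. i \<noteq> l \<longrightarrow> path_image (k j i) \<inter> path_image (k j l) \<subseteq> {n j}))"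
    by metis
  let ?h = "\<lambda>i j. path_image (h i j)" and ?k = "\<lambda>i j. path_image (k j i)"
  have h: "arc (h i j)" "pathstart (h i j) = m i" "pathfinish (h i j) = c i j" "?h i j \<subseteq> ?T i"
    and k: "arc (k j i)" "pathstart (k j i) = n j" "pathfinish (k j i) = c i j" "?k i j \<subseteq> ?U j"
    and mc: "m i \<noteq> c i j" and nc: "n j \<noteq> c i j" if "i \<in> I" "j \<in> J" for i j
    using h0[OF that(1)] k0[OF that(2)] that by auto
  have hh: "?h i j \<inter> ?h i l \<subseteq> {m i}" if "i \<in> I" "j \<in> J" "l \<in> J" "j \<noteq> l" for i j l
    using h0[OF that(1)] that by blast
  have kk: "?k i j \<inter> ?k l j \<subseteq> {n j}" if "i \<in> I" "j \<in> J" "l \<in> I" "i \<noteq> l" for i j l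
    using k0[OF that(2)] that by blast
  have ch: "c i j \<in> ?h i j" and ck: "c i j \<in> ?k i j" if "i \<in> I" "j \<in> J" for i j
    using h(3)[OF that] k(3)[OF that] pathfinish_in_path_image by metis+
  have TU: "?T i \<inter> ?U j \<subseteq> {c i j}" if "i \<in> I" "j \<in> J" for i j
  proof
    fix x assume "x \<in> ?T i \<inter> ?U j"
    then obtain l p where lp: "l \<in> J" "p \<in> I" "x \<in> path_image (\<gamma> i l)" "x \<in> path_image (\<delta> p j)"
      by auto
    then have "l = j \<and> p = i"
      using \<gamma>\<delta>[OF that(1) lp(1,2) that(2)] by auto
    then show "x \<in> {c i j}"
      using meet[OF that] lp by auto
  qed
  have h_k: "?h i j \<inter> ?k p l \<subseteq> {c i l}" if "i \<in> I" "j \<in> J" "p \<in> I" "l \<in> J" for i j p l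
    using h(4)[OF that(1,2)] k(4)[OF that(3,4)] TU[OF that(1,4)] by blast
  have h_h: "?h i j \<inter> ?h p l = {}" if "i \<in> I" "j \<in> J" "p \<in> I" "l \<in> J" "i \<noteq> p" for i j p l
    using h(4)[OF that(1,2)] h(4)[OF that(3,4)] \<gamma>\<gamma>[OF that(1) _ that(3) _ that(5)] by blast
  have k_k: "?k i j \<inter> ?k p l = {}" if "i \<in> I" "j \<in> J" "p \<in> I" "l \<in> J" "j \<noteq> l" for i j p l
    using k(4)[OF that(1,2)] k(4)[OF that(3,4)] \<delta>\<delta>[OF _ that(2) _ that(4,5)] by blast
  \<comment> \<open>The only candidate is \<open>c i l\<close>. It is the end of the leg
    \<open>?k i l\<close>, which meets the leg \<open>?k p l\<close> at most in the hub
    \<open>n l\<close>, and the hub is not an end.\<close>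
  have h_k_disj: "?h i j \<inter> ?k p l = {}" if "i \<in> I" "j \<in> J" "p \<in> I" "l \<in> J" "i \<noteq> p" "j \<noteq> l" for i j p l
    using h_k[OF that(1-4)] kk[OF that(3,4,1)] that(5) ck[OF that(1,4)] nc[OF that(1,4)] by blast
  define E where "E = (\<lambda>i j. h i j +++ reversepath (k j i))"
  have imE: "path_image (E i j) = ?h i j \<union> ?k i j" if "i \<in> I" "j \<in> J" for i j
    unfolding E_def using h(3)[OF that] k(3)[OF that] by (simp add: path_image_join)
  show False
  proof (rule K33_not_planar[OF I J, of E m n])
    fix i j assume ij: "i \<in> I" "j \<in> J"
    show "arc (E i j)"
      unfolding E_def using h[OF ij] k[OF ij] h_k[OF ij ij] by (intro arc_join) (auto simp: arc_reversepath)
    show "pathstart (E i j) = m i" "pathfinish (E i j) = n j"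
      unfolding E_def using h[OF ij] k[OF ij] by simp_all
    {
      fix p l assume pl: "p \<in> I" "l \<in> J" and ne: "i \<noteq> p" "j \<noteq> l"
      show "path_image (E i j) \<inter> path_image (E p l) = {}"
        using h_h[OF ij pl ne(1)] k_k[OF ij pl ne(2)] h_k_disj[OF ij pl ne] h_k_disj[OF pl ij] ne
        unfolding imE[OF ij] imE[OF pl] by blast
    next
      fix l assume l: "l \<in> J" "j \<noteq> l"
      show "path_image (E i j) \<inter> path_image (E i l) \<subseteq> {m i}"
        using hh[OF ij l] hh[OF ij(1) l(1) ij(2)] k_k[OF ij ij(1) l] h_k[OF ij ij(1) l(1)] h_k[OF ij(1) l(1) ij]
          ch[OF ij] ch[OF ij(1) l(1)] l(2) unfolding imE[OF ij] imE[OF ij(1) l(1)] by blast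
    next
      fix p assume p: "p \<in> I" "i \<noteq> p"
      show "path_image (E i j) \<inter> path_image (E p j) \<subseteq> {n j}"
        using kk[OF ij p] kk[OF p(1) ij(2,1)] h_h[OF ij p(1) ij(2) p(2)] h_k[OF ij p(1) ij(2)] h_k[OF p(1) ij(2) ij]
          ck[OF ij] ck[OF p(1) ij(2)] p(2) unfolding imE[OF ij] imE[OF p(1) ij(2)] by blast
    }
  qed
qed

subsection \<open>Disks through bichromatic pairs of six points\<close>

context locally_starlike
begin

text \<open>Among the centres reachable from \<open>c\<^sub>0\<close> without leaving its empty disk, the one of smallest radius
  has geodesics to \<open>a\<close> and \<open>b\<close> that do not touch the bisector again.\<close>
lemma minimal_empty_disk:
  assumes a: "a \<in> P" and b: "b \<in> P" and c0: "c\<^sub>0 \<in> P" "d c\<^sub>0 a = d c\<^sub>0 b"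
    and Q: "Q \<subseteq> P" "\<And>s. s \<in> Q \<Longrightarrow> d c\<^sub>0 a < d c\<^sub>0 s"
  shows "\<exists>c\<in>P. d c a = d c b \<and> (\<forall>s\<in>Q. d c a < d c s) \<and>
    (\<forall>x\<in>P. x \<noteq> c \<longrightarrow> d x a + d x c = d c a \<longrightarrow> d x a < d x b) \<and>
    (\<forall>x\<in>P. x \<noteq> c \<longrightarrow> d x b + d x c = d c b \<longrightarrow> d x b < d x a)"
proof -
  \<comment> \<open>The inequality says that the disk about \<open>x\<close> through
    \<open>a\<close> fits inside the disk about \<open>c\<^sub>0\<close>, in the form supplied by
    the triangle inequality; emptiness is inherited by every member of \<open>?S\<close>.\<close>
  let ?S = "{x \<in> P. d a x = d b x \<and> d c\<^sub>0 x + d a x \<le> d c\<^sub>0 a}"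
  have cont: "continuous_on P (d a)" "continuous_on P (d b)" "continuous_on P (d c\<^sub>0)"
    using a b c0 continuous_on_gdist by auto
  have "?S = {x \<in> P. d a x - d b x = 0} \<inter> {x \<in> P. d c\<^sub>0 x + d a x \<in> {..d c\<^sub>0 a}}"
    by auto
  moreover have "closed {x \<in> P. d a x - d b x = 0}"
    by (intro continuous_closed_preimage_constant continuous_intros cont compact_imp_closed[OF compact])
  moreover have "closed {x \<in> P. d c\<^sub>0 x + d a x \<in> {..d c\<^sub>0 a}}"
    using continuous_closed_preimage[of P "\<lambda>x. d c\<^sub>0 x + d a x" "{..d c\<^sub>0 a}"] cont compact_imp_closed[OF compact]
    by (auto simp: vimage_def Int_def intro!: continuous_intros)
  ultimately have "closed ?S"
    by (simp only: closed_Int)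
  then have "compact ?S"
    using compact_Int_closed[OF compact, of ?S] by (simp add: Int_absorb1)
  moreover have "c\<^sub>0 \<in> ?S"
    using c0 gdist_self[of c\<^sub>0] gdist_commute[of P a] gdist_commute[of P b] by simp
  moreover have "continuous_on ?S (d a)"
    by (rule continuous_on_subset[OF cont(1)]) auto
  ultimately obtain c where c: "c \<in> ?S" and min: "\<And>x. x \<in> ?S \<Longrightarrow> d a c \<le> d a x"
    using continuous_attains_inf[of ?S "d a"] by blast
  have cP: "c \<in> P" and eq: "d c a = d c b" and le: "d c c\<^sub>0 + d c a \<le> d c\<^sub>0 a"
    using c gdist_commute[of P c] by auto
  \<comment> \<open>An equidistant point on a geodesic from \<open>c\<close> to \<open>a\<close>
    would again lie in \<open>?S\<close>, with a radius smaller by \<open>d x c\<close>.\<close>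
  have no: "d x a \<noteq> d x b" if x: "x \<in> P" "x \<noteq> c" "d x a + d x c = d c a" for x
  proof
    assume "d x a = d x b"
    moreover have "d x c\<^sub>0 \<le> d x c + d c c\<^sub>0"
      using gdist_triangle x cP c0 by blast
    ultimately have "x \<in> ?S"
      using x le gdist_commute[of P x] by simp
    from min[OF this] have "d x c \<le> 0"
      using x gdist_commute[of P a] by simp
    then show False
      using gdist_nonneg[OF x(1) cP] gdist_eq_0_iff[OF x(1) cP] x(2) by simp
  qed
  have "d x a < d x b" if x: "x \<in> P" "x \<noteq> c" "d x a + d x c = d c a" for x
    using no[OF x] gdist_triangle[OF cP x(1) b] gdist_commute[of P c x] eq x(3) by linarith
  \<comment> \<open>If \<open>x\<close> were not nearer to \<open>b\<close>, the triangle inequality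
    would make it equidistant and place it on a geodesic from \<open>c\<close> to \<open>a\<close>
    as well, the case already excluded.\<close>
  moreover have "d x b < d x a" if x: "x \<in> P" "x \<noteq> c" "d x b + d x c = d c b" for x
  proof (rule ccontr)
    assume "\<not> d x b < d x a"
    then have "d x a + d x c = d c a" "d x a = d x b"
      using gdist_triangle[OF cP x(1) a] gdist_commute[of P c x] eq x(3) by linarith+
    then show False
      using no x by blast
  qed
  moreover have "d c a < d c s" if s: "s \<in> Q" for s
    using Q(2)[OF s] gdist_triangle[of c\<^sub>0 c s] le gdist_commute[of P c c\<^sub>0] cP c0 Q(1) s by force
  ultimately show ?thesis
    using cP eq by blast
qed

lemma nonempty_disk_among_six:
  assumes I: "card I = 3" and J: "card J = 3" and IJ: "I \<inter> J = {}" "I \<subseteq> P" "J \<subseteq> P"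
    and center: "\<And>a b. a \<in> I \<Longrightarrow> b \<in> J \<Longrightarrow> C a b \<in> P \<and> d (C a b) a = d (C a b) b"
  shows "\<exists>a\<in>I. \<exists>b\<in>J. \<exists>s\<in>(I \<union> J) - {a, b}. d (C a b) s \<le> d (C a b) a"
proof (rule ccontr)
  assume "\<not> ?thesis"
  then have empty: "d (C a b) a < d (C a b) s" if "a \<in> I" "b \<in> J" "s \<in> (I \<union> J) - {a, b}" for a b s
    using that by (meson not_le)
  have "\<exists>c\<in>P. d c a = d c b \<and> (\<forall>s\<in>(I \<union> J) - {a, b}. d c a < d c s) \<and>
    (\<forall>x\<in>P. x \<noteq> c \<longrightarrow> d x a + d x c = d c a \<longrightarrow> d x a < d x b) \<and>
    (\<forall>x\<in>P. x \<noteq> c \<longrightarrow> d x b + d x c = d c b \<longrightarrow> d x b < d x a)" if "a \<in> I" "b \<in> J" for a b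
    by (rule minimal_empty_disk[of a b "C a b"]) (use that center empty IJ in auto)
  then obtain c where c: "\<And>a b. a \<in> I \<Longrightarrow> b \<in> J \<Longrightarrow> c a b \<in> P \<and> d (c a b) a = d (c a b) b \<and>
    (\<forall>s\<in>(I \<union> J) - {a, b}. d (c a b) a < d (c a b) s) \<and>
    (\<forall>x\<in>P. x \<noteq> c a b \<longrightarrow> d x a + d x (c a b) = d (c a b) a \<longrightarrow> d x a < d x b) \<and>
    (\<forall>x\<in>P. x \<noteq> c a b \<longrightarrow> d x b + d x (c a b) = d (c a b) b \<longrightarrow> d x b < d x a)"
    by metis
  have cP: "c a b \<in> P" and ceq: "d (c a b) a = d (c a b) b"
    and cs: "\<And>s. s \<in> (I \<union> J) - {a, b} \<Longrightarrow> d (c a b) a < d (c a b) s"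
    and xa: "\<And>x. x \<in> P \<Longrightarrow> x \<noteq> c a b \<Longrightarrow> d x a + d x (c a b) = d (c a b) a \<Longrightarrow> d x a < d x b"
    and xb: "\<And>x. x \<in> P \<Longrightarrow> x \<noteq> c a b \<Longrightarrow> d x b + d x (c a b) = d (c a b) b \<Longrightarrow> d x b < d x a"
    if "a \<in> I" "b \<in> J" for a b
    using c[OF that] by blast+
  have c_ne: "a \<noteq> c a b" "b \<noteq> c a b" if ab: "a \<in> I" "b \<in> J" for a b
  proof -
    have "a \<noteq> b" "a \<in> P" "b \<in> P"
      using ab IJ by auto
    then show "a \<noteq> c a b" "b \<noteq> c a b"
      using ceq[OF ab] gdist_eq_0_iff[of a b] gdist_eq_0_iff[of b a] gdist_self[of a] gdist_self[of b] by metis+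
  qed
  have "\<exists>g. arc g \<and> pathstart g = a \<and> pathfinish g = c a b \<and> path_image g \<subseteq> P \<and>
    (\<forall>x\<in>path_image g. d a x + d x (c a b) = d a (c a b))" if ab: "a \<in> I" "b \<in> J" for a b
    using geodesic_exists[of a "c a b"] cP[OF ab] c_ne[OF ab] ab IJ by (metis subsetD)
  then obtain \<gamma> where \<gamma>: "\<And>a b. a \<in> I \<Longrightarrow> b \<in> J \<Longrightarrow> arc (\<gamma> a b) \<and> pathstart (\<gamma> a b) = a \<and>
    pathfinish (\<gamma> a b) = c a b \<and> path_image (\<gamma> a b) \<subseteq> P \<and>
    (\<forall>x\<in>path_image (\<gamma> a b). d a x + d x (c a b) = d a (c a b))"
    by metis
  have "\<exists>g. arc g \<and> pathstart g = b \<and> pathfinish g = c a b \<and> path_image g \<subseteq> P \<and>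
    (\<forall>x\<in>path_image g. d b x + d x (c a b) = d b (c a b))" if ab: "a \<in> I" "b \<in> J" for a b
    using geodesic_exists[of b "c a b"] cP[OF ab] c_ne[OF ab] ab IJ by (metis subsetD)
  then obtain \<delta> where \<delta>: "\<And>a b. a \<in> I \<Longrightarrow> b \<in> J \<Longrightarrow> arc (\<delta> a b) \<and> pathstart (\<delta> a b) = b \<and>
    pathfinish (\<delta> a b) = c a b \<and> path_image (\<delta> a b) \<subseteq> P \<and>
    (\<forall>x\<in>path_image (\<delta> a b). d b x + d x (c a b) = d b (c a b))"
    by metis
  \<comment> \<open>Emptiness of the disk carries over from the centre to every point of the
    geodesic by the triangle inequality, which handles \<open>s\<close> other than \<open>b\<close>.
    Against \<open>b\<close> the choice of a minimal centre is needed, and a tie remains at the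
    centre itself.\<close>
  have near_a: "d x a < d x s"
    if ab: "a \<in> I" "b \<in> J" and x: "x \<in> path_image (\<gamma> a b)" and s: "s \<in> I \<union> J" "s \<noteq> a" "s \<noteq> b \<or> x \<noteq> c a b"
    for a b x s
  proof -
    have xP: "x \<in> P" and sum: "d x a + d x (c a b) = d (c a b) a"
      using \<gamma>[OF ab] x gdist_commute[of P a] by auto
    show ?thesis
    proof (cases "s = b")
      case True
      then show ?thesis
        using xa[OF ab xP _ sum] s by auto
    next
      case False
      then have "d (c a b) a < d (c a b) s"
        using cs[OF ab] s by auto
      then show ?thesis
        using gdist_triangle[of "c a b" x s] cP[OF ab] xP s IJ sum gdist_commute[of P x "c a b"] by force
    qed
  qed
  have near_b: "d x b < d x s"
    if ab: "a \<in> I" "b \<in> J" and x: "x \<in> path_image (\<delta> a b)" and s: "s \<in> I \<union> J" "s \<noteq> b" "s \<noteq> a \<or> x \<noteq> c a b"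
    for a b x s
  proof -
    have xP: "x \<in> P" and sum: "d x b + d x (c a b) = d (c a b) b"
      using \<delta>[OF ab] x gdist_commute[of P b] by auto
    show ?thesis
    proof (cases "s = a")
      case True
      then show ?thesis
        using xb[OF ab xP _ sum] s by auto
    next
      case False
      then have "d (c a b) b < d (c a b) s"
        using cs[OF ab] ceq[OF ab] s by auto
      then show ?thesis
        using gdist_triangle[of "c a b" x s] cP[OF ab] xP s IJ sum gdist_commute[of P x "c a b"] by force
    qed
  qed
  show False
  proof (rule K33_stars_not_planar[OF I J, of \<gamma> "\<lambda>a. a" c \<delta> "\<lambda>b. b"])
    fix a b assume ab: "a \<in> I" "b \<in> J"
    then have "a \<noteq> b"
      using IJ by auto
    show "arc (\<gamma> a b) \<and> pathstart (\<gamma> a b) = a \<and> pathfinish (\<gamma> a b) = c a b"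
      "arc (\<delta> a b) \<and> pathstart (\<delta> a b) = b \<and> pathfinish (\<delta> a b) = c a b"
      using \<gamma>[OF ab] \<delta>[OF ab] by auto
    show "path_image (\<gamma> a b) \<inter> path_image (\<delta> a b) \<subseteq> {c a b}"
      using near_a[OF ab, of _ b] near_b[OF ab, of _ a] ab \<open>a \<noteq> b\<close> by force
    fix a' b' assume ab': "a' \<in> I" "b' \<in> J"
    then have ne: "a' \<noteq> b'" "a \<noteq> b'" "a' \<noteq> b"
      using ab IJ by auto
    show "path_image (\<gamma> a b) \<inter> path_image (\<gamma> a' b') = {}" if "a \<noteq> a'"
      using near_a[OF ab, of _ a'] near_a[OF ab', of _ a] ab ab' ne that by force
    show "path_image (\<delta> a b) \<inter> path_image (\<delta> a' b') = {}" if "b \<noteq> b'"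
      using near_b[OF ab, of _ b'] near_b[OF ab', of _ b] ab ab' ne that by force
    show "path_image (\<gamma> a b) \<inter> path_image (\<delta> a' b') = {}" if "(a, b) \<noteq> (a', b')"
    proof (rule ccontr)
      assume "\<not> ?thesis"
      then obtain x where x: "x \<in> path_image (\<gamma> a b)" "x \<in> path_image (\<delta> a' b')"
        by auto
      \<comment> \<open>A tie is possible only between the two points of one pair, at its centre. As
        the pairs differ, at least one of the two opposite comparisons of \<open>d x a\<close> with
        \<open>d x b'\<close> is strict.\<close>
      show False
      proof (cases "b = b'")
        case True
        then have "a \<noteq> a'"
          using that by auto
        then have "d x b' < d x a"
          using near_b[OF ab' x(2), of a] ab ne by auto
        moreover have "d x a \<le> d x b'"
          using near_a[OF ab x(1), of b'] ceq[OF ab] ab' ne True by (cases "x = c a b") auto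
        ultimately show ?thesis
          by simp
      next
        case False
        then have "d x a < d x b'"
          using near_a[OF ab x(1), of b'] ab' ne by auto
        moreover have "d x b' \<le> d x a"
          using near_b[OF ab' x(2), of a] ceq[OF ab'] ab ne by (cases "a = a' \<and> x = c a' b'") auto
        ultimately show ?thesis
          by simp
      qed
    qed
  qed
qed

end

subsection \<open>Polygonal regions\<close>

lemma pedge_compact: "compact (pedge vs i)" and pedge_convex: "convex (pedge vs i)"
  by (simp_all add: pedge_def)

lemma pboundary_compact: "compact (pboundary vs)"
  unfolding pboundary_def by (intro compact_UN) (auto simp: pedge_compact)

lemma pboundary_connected: "connected (pboundary vs)"
proof -
  have "connected (\<Union>i<k. pedge vs i)" if "k \<le> length vs" for k
    using that
  proof (induction k)
    case (Suc k)
    show ?case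
    proof (cases k)
      case 0
      then show ?thesis
        by (simp add: lessThan_Suc convex_connected pedge_convex)
    next
      case (Suc l)
      have "vs ! k \<in> pedge vs l" "vs ! k \<in> pedge vs k"
        using Suc \<open>Suc k \<le> length vs\<close> by (auto simp: pedge_def)
      moreover have "connected (pedge vs k)"
        by (simp add: pedge_def)
      ultimately show ?thesis
        using Suc Suc.IH \<open>Suc k \<le> length vs\<close> unfolding lessThan_Suc UN_insert
        by (intro connected_Un) auto
    qed
  qed simp
  then show ?thesis
    unfolding pboundary_def by blast
qed

text \<open>Choose a ball about \<open>x\<close> that misses all edges not containing
  \<open>x\<close>; a boundary point in it then shares an edge with \<open>x\<close>. For an inside
  point \<open>y\<close> of the ball and \<open>w\<close> on the segment to \<open>x\<close>, either
  the part from \<open>w\<close> to \<open>y\<close> avoids the boundary, so \<open>w\<close> is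
  inside too, or it meets the boundary at some \<open>z\<close>, and \<open>w\<close> lies on the
  segment from \<open>x\<close> to \<open>z\<close>, hence on an edge.\<close>

lemma pregion_locally_starlike: "locally_starlike (pregion vs)"
proof
  have cl: "closed (pboundary vs)"
    using pboundary_compact compact_imp_closed by blast
  have "closed (pregion vs)"
    unfolding pregion_def union_with_inside using open_outside[OF cl] by (simp add: open_closed)
  then show "compact (pregion vs)"
    unfolding compact_eq_bounded_closed pregion_def
    using pboundary_compact[of vs] by (simp add: bounded_inside compact_imp_bounded)
  show "connected (pregion vs)"
    unfolding pregion_def by (rule connected_with_inside[OF cl pboundary_connected])
  fix x assume "x \<in> pregion vs"
  let ?far = "\<Union>i\<in>{i. i < length vs \<and> x \<notin> pedge vs i}. pedge vs i"
  have "closed ?far"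
    by (intro closed_UN) (auto simp: pedge_compact compact_imp_closed)
  then have "open (- ?far)"
    by (rule open_Compl)
  moreover have "x \<in> - ?far"
    by auto
  ultimately obtain e where e: "e > 0" "ball x e \<subseteq> - ?far"
    by (rule openE)
  have near: "\<exists>i < length vs. x \<in> pedge vs i \<and> z \<in> pedge vs i"
    if z: "z \<in> pboundary vs" "dist x z < e" for z
  proof -
    obtain i where i: "i < length vs" "z \<in> pedge vs i"
      using z(1) by (auto simp: pboundary_def)
    moreover have "z \<notin> ?far"
      using z(2) e(2) by auto
    ultimately show ?thesis
      by auto
  qed
  have near_seg: "closed_segment x z \<subseteq> pboundary vs" if z: "z \<in> pboundary vs" "dist x z < e" for z
    using near[OF z] closed_segment_subset[OF _ _ pedge_convex] unfolding pboundary_def by blast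
  have "closed_segment x y \<subseteq> pregion vs" if y: "y \<in> pregion vs" "dist x y < e" for y
  proof (cases "y \<in> pboundary vs")
    case True
    then show ?thesis
      using near_seg y by (auto simp: pregion_def)
  next
    case False
    then have y_in: "y \<in> inside (pboundary vs)"
      using y by (auto simp: pregion_def)
    show ?thesis
    proof
      fix w assume w: "w \<in> closed_segment x y"
      show "w \<in> pregion vs"
      proof (cases "closed_segment w y \<inter> pboundary vs = {}")
        case True
        then have "connected_component (- pboundary vs) y w"
          by (auto simp: connected_component_def intro!: exI[of _ "closed_segment w y"])
        then show ?thesis
          using inside_same_component[OF _ y_in] by (auto simp: pregion_def)
      next
        case False
        then obtain z where z: "z \<in> closed_segment w y" "z \<in> pboundary vs"
          by auto
        have "dist x y = dist x w + dist w y" "dist w y = dist w z + dist z y"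
          using w z by (simp_all add: between_mem_segment[symmetric] between)
        then have "dist x z = dist x w + dist w z" "dist x z < e"
          using dist_triangle[of x y z] dist_triangle[of x z w] y(2) zero_le_dist[of z y] by linarith+
        then have "w \<in> closed_segment x z"
          by (simp add: between_mem_segment[symmetric] between)
        then show ?thesis
          using near_seg[OF z(2) \<open>dist x z < e\<close>] by (auto simp: pregion_def)
      qed
    qed
  qed
  then show "\<exists>e>0. \<forall>y\<in>pregion vs. dist x y < e \<longrightarrow> closed_segment x y \<subseteq> pregion vs"
    using e(1) by blast
qed

subsection \<open>Double counting\<close>

lemma card_subsets_containing:
  assumes "finite S" "A \<subseteq> S" "card A \<le> k"
  shows "card {X. X \<subseteq> S \<and> card X = k \<and> A \<subseteq> X} = (card S - card A) choose (k - card A)"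
proof -
  have fin: "finite A"
    using assms finite_subset by blast
  have "bij_betw (\<lambda>Y. Y \<union> A) {Y. Y \<subseteq> S - A \<and> card Y = k - card A} {X. X \<subseteq> S \<and> card X = k \<and> A \<subseteq> X}"
  proof (rule bij_betw_byWitness[where f' = "\<lambda>X. X - A"])
    show "(\<lambda>Y. Y \<union> A) ` {Y. Y \<subseteq> S - A \<and> card Y = k - card A} \<subseteq> {X. X \<subseteq> S \<and> card X = k \<and> A \<subseteq> X}"
    proof
      fix X assume "X \<in> (\<lambda>Y. Y \<union> A) ` {Y. Y \<subseteq> S - A \<and> card Y = k - card A}"
      then obtain Y where Y: "X = Y \<union> A" "Y \<subseteq> S - A" "card Y = k - card A"
        by auto
      moreover have "finite Y"
        using Y(2) assms(1) by (meson finite_Diff finite_subset)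
      moreover have "Y \<inter> A = {}"
        using Y(2) by auto
      ultimately have "card X = k"
        using fin assms(3) by (simp add: card_Un_disjoint)
      then show "X \<in> {X. X \<subseteq> S \<and> card X = k \<and> A \<subseteq> X}"
        using Y assms(2) by auto
    qed
    show "(\<lambda>X. X - A) ` {X. X \<subseteq> S \<and> card X = k \<and> A \<subseteq> X} \<subseteq> {Y. Y \<subseteq> S - A \<and> card Y = k - card A}"
      using fin by (auto simp: card_Diff_subset)
  qed auto
  then have "card {X. X \<subseteq> S \<and> card X = k \<and> A \<subseteq> X} = card {Y. Y \<subseteq> S - A \<and> card Y = k - card A}"
    by (rule bij_betw_same_card[symmetric])
  also have "\<dots> = card (S - A) choose (k - card A)"
    using assms(1) by (intro n_subsets) auto
  finally show ?thesis
    using assms fin by (simp add: card_Diff_subset)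
qed

lemma bichromatic_pair_by_counting:
  assumes fin: "finite R" "finite B" and "R \<inter> B = {}" and m: "card R = m" "card B = m" "3 \<le> m"
    and D: "\<And>r b. r \<in> R \<Longrightarrow> b \<in> B \<Longrightarrow> D r b \<subseteq> R \<union> B - {r, b}"
    and hit: "\<And>X Y. X \<subseteq> R \<Longrightarrow> Y \<subseteq> B \<Longrightarrow> card X = 3 \<Longrightarrow> card Y = 3 \<Longrightarrow>
      \<exists>r\<in>X. \<exists>b\<in>Y. D r b \<inter> (X \<union> Y) \<noteq> {}"
  shows "\<exists>r\<in>R. \<exists>b\<in>B. m - 1 \<le> 18 * card (D r b)"
proof (rule ccontr)
  assume "\<not> ?thesis"
  then have small: "18 * card (D r b) < m - 1" if "r \<in> R" "b \<in> B" for r b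
    using that by force
  define \<Omega> where "\<Omega> = (\<lambda>A C. {X. X \<subseteq> R \<and> card X = 3 \<and> A \<subseteq> X} \<times> {Y. Y \<subseteq> B \<and> card Y = 3 \<and> C \<subseteq> Y})"
  define q where "q = (m - 2) * ((m - 1) choose 2)"
  have card_\<Omega>: "card (\<Omega> A C) = ((m - card A) choose (3 - card A)) * ((m - card C) choose (3 - card C))"
    if "A \<subseteq> R" "C \<subseteq> B" "card A \<le> 3" "card C \<le> 3" for A C
    unfolding \<Omega>_def card_cartesian_product
    using card_subsets_containing[OF fin(1) that(1,3)] card_subsets_containing[OF fin(2) that(2,4)] m by simp
  \<comment> \<open>Intersecting \<open>{s}\<close> with each colour class adds \<open>s\<close> on
    the side of its own colour. Both classes have \<open>m\<close> points, so the count is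
    \<open>q\<close> in either case.\<close>
  define \<Psi> where "\<Psi> = (\<lambda>r b s. \<Omega> ({r} \<union> {s} \<inter> R) ({b} \<union> {s} \<inter> B))"
  have card_\<Psi>: "card (\<Psi> r b s) = q" if "r \<in> R" "b \<in> B" "s \<in> D r b" for r b s
  proof -
    have "s \<noteq> r" "s \<noteq> b" "s \<in> R \<union> B"
      using D that by auto
    then consider "s \<in> R" "s \<notin> B" | "s \<in> B" "s \<notin> R"
      using \<open>R \<inter> B = {}\<close> by auto
    then show ?thesis
    proof cases
      case 1
      then have "\<Psi> r b s = \<Omega> {r, s} {b}"
        by (simp add: \<Psi>_def insert_commute)
      moreover have "card {r, s} = 2"
        using \<open>s \<noteq> r\<close> by simp
      ultimately show ?thesis
        using card_\<Omega>[of "{r, s}" "{b}"] 1 that by (simp add: q_def)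
    next
      case 2
      then have "\<Psi> r b s = \<Omega> {r} {b, s}"
        by (simp add: \<Psi>_def insert_commute)
      moreover have "card {b, s} = 2"
        using \<open>s \<noteq> b\<close> by simp
      ultimately show ?thesis
        using card_\<Omega>[of "{r}" "{b, s}"] 2 that by (simp add: q_def)
    qed
  qed
  have "\<Omega> {} {} \<subseteq> (\<Union>p\<in>R \<times> B. \<Union>s\<in>D (fst p) (snd p). \<Psi> (fst p) (snd p) s)"
  proof
    fix p assume "p \<in> \<Omega> {} {}"
    then obtain X Y where p: "p = (X, Y)" "X \<subseteq> R" "card X = 3" "Y \<subseteq> B" "card Y = 3"
      by (auto simp: \<Omega>_def)
    then obtain r b s where rbs: "r \<in> X" "b \<in> Y" "s \<in> D r b" "s \<in> X \<union> Y"
      using hit[of X Y] by blast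
    then have "p \<in> \<Psi> r b s"
      using p \<open>R \<inter> B = {}\<close> by (auto simp: \<Psi>_def \<Omega>_def)
    then show "p \<in> (\<Union>p\<in>R \<times> B. \<Union>s\<in>D (fst p) (snd p). \<Psi> (fst p) (snd p) s)"
      using rbs p by force
  qed
  moreover have finD: "finite (D r b)" if "r \<in> R" "b \<in> B" for r b
    using D[OF that] fin by (meson finite_Diff finite_UnI finite_subset)
  moreover have "finite (\<Psi> r b s)" for r b s
    using fin unfolding \<Psi>_def \<Omega>_def by (auto intro!: finite_cartesian_product)
  ultimately have "card (\<Omega> {} {}) \<le> card (\<Union>p\<in>R \<times> B. \<Union>s\<in>D (fst p) (snd p). \<Psi> (fst p) (snd p) s)"
    using fin by (intro card_mono) auto
  also have "\<dots> \<le> (\<Sum>p\<in>R \<times> B. card (\<Union>s\<in>D (fst p) (snd p). \<Psi> (fst p) (snd p) s))"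
    using fin by (intro card_UN_le) auto
  also have "\<dots> \<le> (\<Sum>p\<in>R \<times> B. card (D (fst p) (snd p)) * q)"
  proof (rule sum_mono)
    fix p assume p: "p \<in> R \<times> B"
    have "card (\<Union>s\<in>D (fst p) (snd p). \<Psi> (fst p) (snd p) s) \<le> (\<Sum>s\<in>D (fst p) (snd p). card (\<Psi> (fst p) (snd p) s))"
      using p finD by (intro card_UN_le) auto
    also have "\<dots> = (\<Sum>s\<in>D (fst p) (snd p). q)"
      using p card_\<Psi> by (intro sum.cong) auto
    finally show "card (\<Union>s\<in>D (fst p) (snd p). \<Psi> (fst p) (snd p) s) \<le> card (D (fst p) (snd p)) * q"
      by simp
  qed
  finally have le: "card (\<Omega> {} {}) \<le> (\<Sum>p\<in>R \<times> B. card (D (fst p) (snd p)) * q)" .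
  have "q > 0"
    using m by (simp add: q_def)
  have "18 * card (\<Omega> {} {}) \<le> (\<Sum>p\<in>R \<times> B. 18 * card (D (fst p) (snd p)) * q)"
    using mult_le_mono2[OF le, of 18] by (simp add: sum_distrib_left mult.assoc)
  also have "\<dots> < (\<Sum>p\<in>R \<times> B. (m - 1) * q)"
    using small \<open>q > 0\<close> fin m by (intro sum_strict_mono) auto
  also have "\<dots> = m ^ 2 * (m - 1) * q"
    using m by (simp add: power2_eq_square card_cartesian_product)
  finally have "18 * (m choose 3) ^ 2 < m ^ 2 * (m - 1) * q"
    using card_\<Omega>[of "{}" "{}"] by (simp add: power2_eq_square)
  \<comment> \<open>With \<open>c\<close> for \<open>(m - 1) choose 2\<close>: absorption gives
    \<open>3 * (m choose 3) = m * c\<close> and \<open>2 * c = (m - 1) * (m - 2)\<close>. Squaring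
    the first produces 9, and one factor \<open>c\<close> needs the 2, so 18 makes the averaging an
    exact identity.\<close>
  moreover have "18 * (m choose 3) ^ 2 = m ^ 2 * (m - 1) * q"
  proof -
    let ?c = "(m - 1) choose 2"
    have three: "3 * (m choose 3) = m * ?c"
      using binomial_absorption[of 2 m] by simp
    have "Suc 1 = (2::nat)"
      by simp
    from binomial_absorption[of 1 "m - 1", unfolded this] have two: "2 * ?c = (m - 1) * (m - 2)"
      by (simp add: numeral_2_eq_2)
    have "18 * (m choose 3) ^ 2 = 2 * (3 * (m choose 3)) ^ 2"
      by (simp add: power2_eq_square)
    also have "\<dots> = m ^ 2 * ?c * (2 * ?c)"
      unfolding three by (simp add: power2_eq_square)
    finally show ?thesis
      unfolding two q_def by (simp add: mult_ac)
  qed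
  ultimately show False
    by simp
qed

section \<open>From the averaged count to the stated bound\<close>

theorem theorem9:
  fixes n :: nat and vs :: "complex list" and R B :: "complex set"
  assumes "even n" and "n \<ge> 6"
    and "simple_polygon_vertices vs"
    and "finite R" and "finite B" and "R \<inter> B = {}"
    and "card R = n div 2" and "card B = n div 2"
    and "R \<union> B \<subseteq> pregion vs"
    and "general_position vs (R \<union> B)"
  shows "\<exists>r\<in>R. \<exists>b\<in>B. \<forall>c\<in>pregion vs. \<forall>rad.
           gdist (pregion vs) c r = rad \<and> gdist (pregion vs) c b = rad \<longrightarrow>
           card {s \<in> R \<union> B. gdist (pregion vs) c s \<le> rad} \<ge> nat \<lceil>(real n - 2) / 36\<rceil> + 2"
proof (rule ccontr)
  let ?P = "pregion vs" and ?K = "nat \<lceil>(real n - 2) / 36\<rceil>"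
  interpret locally_starlike ?P
    by (rule pregion_locally_starlike)
  assume contra: "\<not> ?thesis"
  have "\<exists>c\<in>?P. gdist ?P c r = gdist ?P c b \<and>
      card {s \<in> R \<union> B. gdist ?P c s \<le> gdist ?P c r} < ?K + 2" if rb: "r \<in> R" "b \<in> B" for r b
  proof (rule ccontr)
    assume no: "\<not> ?thesis"
    have "?K + 2 \<le> card {s \<in> R \<union> B. gdist ?P c s \<le> rad}"
      if c: "c \<in> ?P" "gdist ?P c r = rad \<and> gdist ?P c b = rad" for c rad
    proof (rule ccontr)
      assume "\<not> ?thesis"
      then have "card {s \<in> R \<union> B. gdist ?P c s \<le> gdist ?P c r} < ?K + 2"
        using c(2) by simp
      moreover have "gdist ?P c r = gdist ?P c b"
        using c(2) by simp
      ultimately show False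
        using no c(1) by blast
    qed
    then show False
      using contra rb by blast
  qed
  moreover define good where "good = (\<lambda>r b c. c \<in> ?P \<and> gdist ?P c r = gdist ?P c b \<and>
      card {s \<in> R \<union> B. gdist ?P c s \<le> gdist ?P c r} < ?K + 2)"
  ultimately have "\<exists>c. good r b c" if "r \<in> R" "b \<in> B" for r b
    using that by blast
  \<comment> \<open>One bad disk is fixed for every pair before any six points are selected; this is
    harmless because the six-point argument holds for every assignment of equidistant
    centres.\<close>
  then obtain C where "\<And>r b. r \<in> R \<Longrightarrow> b \<in> B \<Longrightarrow> good r b (C r b)"
    by metis
  then have C: "C r b \<in> ?P" "gdist ?P (C r b) r = gdist ?P (C r b) b"
    "card {s \<in> R \<union> B. gdist ?P (C r b) s \<le> gdist ?P (C r b) r} < ?K + 2" if "r \<in> R" "b \<in> B" for r b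
    using that unfolding good_def by blast+
  define D where "D = (\<lambda>r b. {s \<in> R \<union> B. gdist ?P (C r b) s \<le> gdist ?P (C r b) r} - {r, b})"
  have "\<exists>r\<in>R. \<exists>b\<in>B. n div 2 - 1 \<le> 18 * card (D r b)"
  proof (rule bichromatic_pair_by_counting)
    fix X Y assume XY: "X \<subseteq> R" "Y \<subseteq> B" "card X = 3" "card Y = 3"
    have "\<exists>r\<in>X. \<exists>b\<in>Y. \<exists>s\<in>(X \<union> Y) - {r, b}. gdist ?P (C r b) s \<le> gdist ?P (C r b) r"
    proof (rule nonempty_disk_among_six[OF XY(3,4)])
      show "X \<inter> Y = {}" "X \<subseteq> ?P" "Y \<subseteq> ?P"
        using XY \<open>R \<inter> B = {}\<close> \<open>R \<union> B \<subseteq> ?P\<close> by auto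
      show "C r b \<in> ?P \<and> gdist ?P (C r b) r = gdist ?P (C r b) b" if "r \<in> X" "b \<in> Y" for r b
        using C(1,2)[of r b] XY that by auto
    qed
    then show "\<exists>r\<in>X. \<exists>b\<in>Y. D r b \<inter> (X \<union> Y) \<noteq> {}"
      using XY unfolding D_def by blast
  qed (use assms(2,4-8) in \<open>auto simp: D_def\<close>)
  then obtain r b where rb: "r \<in> R" "b \<in> B" and large: "n div 2 - 1 \<le> 18 * card (D r b)"
    by blast
  let ?S = "{s \<in> R \<union> B. gdist ?P (C r b) s \<le> gdist ?P (C r b) r}"
  have "r \<noteq> b" "{r, b} \<subseteq> ?S" "finite ?S"
    using rb C(2)[OF rb] \<open>R \<inter> B = {}\<close> \<open>finite R\<close> \<open>finite B\<close> by auto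
  then have "card ?S = card (D r b) + 2"
    using card_Diff_subset[of "{r, b}" ?S] card_mono[of ?S "{r, b}"] by (simp add: D_def)
  then have "card (D r b) < ?K"
    using C(3)[OF rb] by simp
  \<comment> \<open>A natural number lies below the ceiling of a real exactly when it lies below the
    real itself, so no rounding is lost. Evenness of \<open>n\<close> then turns
    \<open>n div 2 - 1\<close> into half of \<open>n - 2\<close>, contradicting
    \<open>large\<close>.\<close>
  then have "real (card (D r b)) < (real n - 2) / 36"
    by (simp add: zless_nat_eq_int_zless less_ceiling_iff)
  then show False
    using large \<open>even n\<close> \<open>n \<ge> 6\<close> by (auto elim!: evenE)
qed

end
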